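(* Let $D\subset\mathbb{C}^n$ be a domain and let $U$ be a neighborhood of a plurisubharmonic peak point $p_0\in\partial D$. If $\lim_{z\to p_0}s_D(z)=1$, then $\lim_{z\to p_0}s_{D\cap U}(z)=1$, where $s$ denotes the squeezing function.
   Context: $\mathbb{B}_n\subset\mathbb{C}^n$ is the open unit ball; $\mathcal{O}(X,Y)$ is the set of holomorphic maps from $X$ to $Y$. Squeezing function: for $z\in D$, $$s_D(z)=\sup\{r>0 : r\mathbb{B}_n\subset f(D),\ f\in\mathcal{O}(D,\mathbb{B}_n),\ f(z)=0,\ f \text{ injective}\},$$ with $s_D=0$ if no injective $f\in\mathcal{O}(D,\mathbb{B}_n)$ exists (i.e. $D$ is not biholomorphic to a bounded domain). The same definition is used verbatim for the open set $D\cap U$. Limits as $z\to p_0$ are taken over points of the corresponding set ($D$ or $D\cap U$). A point $p_0\in\partial D$ is a plurisubharmonic peak point (of $D$) if there is a plurisubharmonic function $\varphi<0$ on $D$ with $\lim_{z\to p_0}\varphi(z)=0$ and $\sup_{D\setminus V}\varphi<0$ for every neighborhood $V$ of $p_0$. (This notion is local in character: it depends only on $D$ near $p_0$.) *)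

theory Defs
  imports "HOL-Analysis.Analysis"
begin

definition holomorphic_map_on :: "(complex^'n \<Rightarrow> complex^'m) \<Rightarrow> (complex^'n) set \<Rightarrow> bool" where
  "holomorphic_map_on f D \<longleftrightarrow>
     (\<forall>z\<in>D. \<exists>f'. (f has_derivative f') (at z) \<and> (\<forall>c v. f' (c *s v) = c *s f' v))"

(* The type complex^'n carries the Hermitian norm, so that ball 0 r is the Euclidean ball of
   radius r in C^n. The supremum is a real supremum; the set is nonempty and bounded by 1
   whenever D is open, z is in D and the condition of the conditional holds. *)
definition squeezing :: "(complex^'n) set \<Rightarrow> complex^'n \<Rightarrow> real" where
  "squeezing D z =
     (if \<exists>f :: complex^'n \<Rightarrow> complex^'n.
           holomorphic_map_on f D \<and> f ` D \<subseteq> ball 0 1 \<and> inj_on f D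
      then Sup {r. r > 0 \<and> (\<exists>f :: complex^'n \<Rightarrow> complex^'n.
             holomorphic_map_on f D \<and> f ` D \<subseteq> ball 0 1 \<and> inj_on f D \<and> f z = 0 \<and>
             ball 0 r \<subseteq> f ` D)}
      else 0)"

(* Mean value over the unit circle, as the integral of the positive part minus that of the
   negative part (e2ennreal sends negative values to 0). For upper semicontinuous u without the
   value +\<infinity> the first integral is finite, so the difference is meaningful and may be -\<infinity>. *)
definition circle_mean :: "(complex \<Rightarrow> ereal) \<Rightarrow> ereal" where
  "circle_mean u =
     (enn2ereal (\<integral>\<^sup>+t\<in>{0..2*pi}. e2ennreal (u (cis t)) \<partial>lborel)
      - enn2ereal (\<integral>\<^sup>+t\<in>{0..2*pi}. e2ennreal (- u (cis t)) \<partial>lborel)) / ereal (2*pi)"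

(* Values in [-\<infinity>,\<infinity>), upper semicontinuous, and subharmonic along complex lines (sub-mean value
   property on every closed affine disc contained in D). The function that is constantly -\<infinity> is
   admitted. *)
definition plurisubharmonic_on :: "(complex^'n \<Rightarrow> ereal) \<Rightarrow> (complex^'n) set \<Rightarrow> bool" where
  "plurisubharmonic_on \<phi> D \<longleftrightarrow>
     (\<forall>z\<in>D. \<phi> z < \<infinity>) \<and>
     (\<forall>c. openin (top_of_set D) {z\<in>D. \<phi> z < c}) \<and>
     (\<forall>a b. (\<forall>\<zeta>. norm \<zeta> \<le> 1 \<longrightarrow> a + \<zeta> *s b \<in> D) \<longrightarrow> \<phi> a \<le> circle_mean (\<lambda>\<zeta>. \<phi> (a + \<zeta> *s b)))"

definition psh_peak_point :: "(complex^'n) set \<Rightarrow> complex^'n \<Rightarrow> bool" where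
  "psh_peak_point D p \<longleftrightarrow> p \<in> frontier D \<and>
     (\<exists>\<phi>. plurisubharmonic_on \<phi> D \<and> (\<forall>z\<in>D. \<phi> z < 0) \<and>
          (\<phi> \<longlongrightarrow> 0) (at p within D) \<and>
          (\<forall>V. open V \<and> p \<in> V \<longrightarrow> (SUP z\<in>D - V. \<phi> z) < 0))"

end

theory Submission
  imports Defs "HOL-Complex_Analysis.Complex_Analysis"
begin

text \<open>For \<^term>\<open>z\<close> close to \<^term>\<open>p0\<close> take an injective holomorphic map \<^term>\<open>f\<close> of \<^term>\<open>D\<close> into the unit
  ball that sends \<^term>\<open>z\<close> to \<^term>\<open>0\<close> and whose image contains a ball of radius close to 1. It
  suffices that the inverse of \<^term>\<open>f\<close> maps a slightly smaller ball into \<^term>\<open>U\<close>, for then the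
  restriction of \<^term>\<open>f\<close> is a competitor for \<^term>\<open>squeezing (D \<inter> U) z\<close>.

  Restrict the inverse of \<^term>\<open>f\<close> to a complex line through \<^term>\<open>0\<close>. If some point of the resulting
  disc is mapped far from \<^term>\<open>p0\<close>, then by the maximum principle so are points on every circle
  around it. There the peak function is at most some \<^term>\<open>- c\<close>, and a comparison with the potential of a
  finite Blaschke product vanishing at such points (a form of Beurling's projection estimate)
  bounds the peak function at the centre \<^term>\<open>z\<close> away from 0.

  Plurisubharmonicity is only assumed along affine discs, whereas the inverse of \<^term>\<open>f\<close> maps lines to
  curved ones. The maximum principle along these is obtained by doubling the variables: one
  maximizes over pairs of a point \<^term>\<open>z\<close> and a parameter \<^term>\<open>\<xi>\<close> with a penalty on \<^term>\<open>f z - \<xi> *s b\<close>. Only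
  the continuity of the inverse of \<^term>\<open>f\<close> is needed for this.\<close>

section \<open>Circle means, subharmonicity along lines and truncation\<close>

text \<open>The positive and negative parts of \<open>\<Psi>\<close> have finite integrals and bound
  the two integrals in \<open>circle_mean\<close> from above and from below. Nonnegative integrals
  are monotone without measurability, so \<open>u\<close> may be arbitrary.\<close>

lemma circle_mean_le:
  fixes \<Psi> :: "real \<Rightarrow> real"
  assumes cont: "continuous_on {0..2*pi} \<Psi>" and int: "(\<Psi> has_integral I) {0..2*pi}"
    and le: "\<And>t. t \<in> {0..2*pi} \<Longrightarrow> u (cis t) \<le> ereal (\<Psi> t)"
  shows "circle_mean u \<le> ereal (I / (2*pi))"
proof -
  define P where "P = (\<lambda>t. max 0 (\<Psi> t))"
  define N where "N = (\<lambda>t. max 0 (- \<Psi> t))"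
  define J :: "(real \<Rightarrow> real) \<Rightarrow> real" where
    "J = (\<lambda>f. integral\<^sup>L lborel (\<lambda>t. indicator {0..2*pi} t * f t))"
  have contP: "continuous_on {0..2*pi} P" and contN: "continuous_on {0..2*pi} N"
    unfolding P_def N_def by (intro continuous_intros cont)+
  have iP: "set_integrable lborel {0..2*pi} P" and iN: "set_integrable lborel {0..2*pi} N"
    and i\<Psi>: "set_integrable lborel {0..2*pi} \<Psi>"
    using contP contN cont by (auto intro: borel_integrable_atLeastAtMost')
  have nP: "(\<integral>\<^sup>+t\<in>{0..2*pi}. ennreal (P t) \<partial>lborel) = ennreal (J P)"
    unfolding J_def
    by (subst nn_integral_eq_integral[symmetric])
       (use iP in \<open>auto simp: set_integrable_def P_def indicator_def intro!: nn_integral_cong\<close>)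
  have nN: "(\<integral>\<^sup>+t\<in>{0..2*pi}. ennreal (N t) \<partial>lborel) = ennreal (J N)"
    unfolding J_def
    by (subst nn_integral_eq_integral[symmetric])
       (use iN in \<open>auto simp: set_integrable_def N_def indicator_def intro!: nn_integral_cong\<close>)
  have pos: "J P \<ge> 0" "J N \<ge> 0"
    unfolding J_def P_def N_def by (auto intro!: Bochner_Integration.integral_nonneg)
  have "J P - J N = integral\<^sup>L lborel (\<lambda>t. indicator {0..2*pi} t * P t - indicator {0..2*pi} t * N t)"
    unfolding J_def using iP iN by (simp add: set_integrable_def)
  also have "\<dots> = J \<Psi>"
    unfolding J_def P_def N_def by (intro Bochner_Integration.integral_cong) (auto simp: max_def indicator_def)
  also have "\<dots> = integral {0..2*pi} \<Psi>"
    using set_borel_integral_eq_integral(2)[OF i\<Psi>] by (simp add: J_def set_lebesgue_integral_def)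
  also have "\<dots> = I" using int by (rule integral_unique)
  finally have diff: "J P - J N = I" .
  have "(\<integral>\<^sup>+t\<in>{0..2*pi}. e2ennreal (u (cis t)) \<partial>lborel) \<le> (\<integral>\<^sup>+t\<in>{0..2*pi}. ennreal (P t) \<partial>lborel)"
  proof (intro nn_integral_mono)
    fix t
    have "e2ennreal (u (cis t)) \<le> ennreal (P t)" if "t \<in> {0..2*pi}"
    proof -
      have "u (cis t) \<le> ereal (P t)" using le[OF that] unfolding P_def
        by (meson ereal_less_eq(3) max.cobounded2 order_trans)
      then show ?thesis by (metis e2ennreal_ereal e2ennreal_mono)
    qed
    then show "e2ennreal (u (cis t)) * indicator {0..2*pi} t \<le> ennreal (P t) * indicator {0..2*pi} t"
      by (auto simp: indicator_def)
  qed
  then have le1: "enn2ereal (\<integral>\<^sup>+t\<in>{0..2*pi}. e2ennreal (u (cis t)) \<partial>lborel) \<le> ereal (J P)"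
    using nP pos by (metis enn2ereal_ennreal less_eq_ennreal.rep_eq)
  have "(\<integral>\<^sup>+t\<in>{0..2*pi}. ennreal (N t) \<partial>lborel) \<le> (\<integral>\<^sup>+t\<in>{0..2*pi}. e2ennreal (- u (cis t)) \<partial>lborel)"
  proof (intro nn_integral_mono)
    fix t
    have "ennreal (N t) \<le> e2ennreal (- u (cis t))" if "t \<in> {0..2*pi}"
    proof -
      have "ereal (- \<Psi> t) \<le> - u (cis t)" using le[OF that]
        by (metis ereal_minus_le_minus uminus_ereal.simps(1))
      then have "e2ennreal (ereal (- \<Psi> t)) \<le> e2ennreal (- u (cis t))" by (rule e2ennreal_mono)
      then show ?thesis by (auto simp: N_def max_def e2ennreal_ereal)
    qed
    then show "ennreal (N t) * indicator {0..2*pi} t \<le> e2ennreal (- u (cis t)) * indicator {0..2*pi} t"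
      by (auto simp: indicator_def)
  qed
  then have le2: "ereal (J N) \<le> enn2ereal (\<integral>\<^sup>+t\<in>{0..2*pi}. e2ennreal (- u (cis t)) \<partial>lborel)"
    using nN pos by (metis enn2ereal_ennreal less_eq_ennreal.rep_eq)
  have "circle_mean u \<le> (ereal (J P) - ereal (J N)) / ereal (2*pi)"
    unfolding circle_mean_def by (intro ereal_divide_right_mono ereal_minus_mono le1 le2) simp
  also have "\<dots> = ereal (I / (2*pi))" using diff by simp
  finally show ?thesis .
qed

lemma has_integral_cis_Re:
  assumes "G holomorphic_on cball 0 1"
  shows "((\<lambda>t. Re (G (cis t))) has_integral (2*pi * Re (G 0))) {0..2*pi}"
proof -
  have "((\<lambda>u. G u / (u - 0)) has_contour_integral 2 * complex_of_real pi * \<i> * G 0) (circlepath 0 1)"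
    using Cauchy_integral_circlepath_simple[OF assms, of 0] by simp
  then have "((\<lambda>t. G (cis t) * \<i>) has_integral 2 * complex_of_real pi * \<i> * G 0) {0..2*pi}"
    by (simp add: circlepath_def has_contour_integral_part_circlepath_iff)
  from has_integral_mult_right[OF this, of "-\<i>"]
  have "((\<lambda>t. G (cis t)) has_integral 2 * complex_of_real pi * G 0) {0..2*pi}"
    by (simp add: mult_ac)
  from has_integral_Re[OF this] show ?thesis by simp
qed

text \<open>Testing against real parts of holomorphic functions replaces the circle mean, so that
  measurability of \<^term>\<open>u\<close> plays no role.\<close>
definition line_subharmonic_on :: "(complex^'n \<Rightarrow> real) \<Rightarrow> (complex^'n) set \<Rightarrow> bool" where
  "line_subharmonic_on u D \<longleftrightarrow>
     (\<forall>z v G. G holomorphic_on cball 0 1 \<longrightarrow> (\<forall>\<zeta>\<in>cball 0 1. z + \<zeta> *s v \<in> D) \<longrightarrow>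
        (\<forall>\<zeta>\<in>sphere 0 1. u (z + \<zeta> *s v) \<le> Re (G \<zeta>)) \<longrightarrow> u z \<le> Re (G 0))"

text \<open>The cut-off makes the function real-valued where \<open>\<phi>\<close> is
  \<open>- \<infinity>\<close> and leaves values above \<open>- c\<close> unchanged.\<close>

definition truncate_at :: "real \<Rightarrow> ('a \<Rightarrow> ereal) \<Rightarrow> 'a \<Rightarrow> real" where
  "truncate_at c \<phi> z = real_of_ereal (max (\<phi> z) (ereal (- c)))"

lemma ereal_truncate_at:
  assumes "\<phi> z < \<infinity>"
  shows "ereal (truncate_at c \<phi> z) = max (\<phi> z) (ereal (- c))"
  using assms unfolding truncate_at_def by (cases "\<phi> z") (auto simp: max_def)

text \<open>On the circle \<open>Re G\<close> dominates both \<open>\<phi>\<close> and the constant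
  \<open>- c\<close>. The sub-mean value inequality carries the first bound to the centre,
  integration the second.\<close>

lemma line_subharmonic_on_truncate_at:
  assumes "plurisubharmonic_on \<phi> D"
  shows "line_subharmonic_on (truncate_at c \<phi>) D"
  unfolding line_subharmonic_on_def
proof (intro allI impI)
  fix z v and G :: "complex \<Rightarrow> complex"
  assume G: "G holomorphic_on cball 0 1" and D: "\<forall>\<zeta>\<in>cball 0 1. z + \<zeta> *s v \<in> D"
    and le: "\<forall>\<zeta>\<in>sphere 0 1. truncate_at c \<phi> (z + \<zeta> *s v) \<le> Re (G \<zeta>)"
  have fin: "\<phi> y < \<infinity>" if "y \<in> D" for y using assms that by (auto simp: plurisubharmonic_on_def)
  have tr: "ereal (truncate_at c \<phi> y) = max (\<phi> y) (ereal (- c))" if "y \<in> D" for y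
    using ereal_truncate_at[of \<phi> y c] fin[OF that] by simp
  have maj: "max (\<phi> (z + \<zeta> *s v)) (ereal (- c)) \<le> ereal (Re (G \<zeta>))" if "norm \<zeta> = 1" for \<zeta>
    using le D that tr[of "z + \<zeta> *s v"]
    by (metis ereal_less_eq(3) mem_cball_0 mem_sphere_0 order_refl)
  have int: "((\<lambda>t. Re (G (cis t))) has_integral (2*pi * Re (G 0))) {0..2*pi}"
    using G by (rule has_integral_cis_Re)
  have cont: "continuous_on {0..2*pi} (\<lambda>t. Re (G (cis t)))"
    by (intro continuous_intros continuous_on_compose2[OF holomorphic_on_imp_continuous_on[OF G]]) auto
  have zD: "z \<in> D" using D[rule_format, of 0] by simp
  have "\<phi> z \<le> circle_mean (\<lambda>\<zeta>. \<phi> (z + \<zeta> *s v))"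
    using assms D by (auto simp: plurisubharmonic_on_def)
  also have "\<dots> \<le> ereal (2*pi * Re (G 0) / (2*pi))"
    by (rule circle_mean_le[OF cont int]) (use maj in auto)
  finally have 1: "\<phi> z \<le> ereal (Re (G 0))" by simp
  have "((\<lambda>t. - c) has_integral (2*pi * (- c))) {0..2*pi}"
    using has_integral_const_real[of "- c" 0 "2*pi"] by simp
  from has_integral_le[OF this int] maj have "2*pi * (- c) \<le> 2*pi * Re (G 0)" by auto
  from mult_left_le_imp_le[OF this] have 2: "- c \<le> Re (G 0)" by simp
  from 1 2 have "ereal (truncate_at c \<phi> z) \<le> ereal (Re (G 0))"
    unfolding tr[OF zD] by auto
  then show "truncate_at c \<phi> z \<le> Re (G 0)" by simp
qed

lemma open_truncate_at_less:
  assumes "plurisubharmonic_on \<phi> D" "open D"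
  shows "open {z\<in>D. truncate_at c \<phi> z < a}"
proof (cases "a \<le> - c")
  case True
  have "\<not> truncate_at c \<phi> z < a" if "z \<in> D" for z
    using ereal_truncate_at[of \<phi> z c] assms that True
    by (metis ereal_less_eq(3) leD max.cobounded2 order_trans plurisubharmonic_on_def)
  then have "{z\<in>D. truncate_at c \<phi> z < a} = {}" by auto
  then show ?thesis by (metis open_empty)
next
  case False
  have "truncate_at c \<phi> z < a \<longleftrightarrow> \<phi> z < ereal a" if "z \<in> D" for z
  proof -
    have "ereal (truncate_at c \<phi> z) = max (\<phi> z) (ereal (- c))"
      using ereal_truncate_at[of \<phi> z c] assms that by (auto simp: plurisubharmonic_on_def)
    then show ?thesis using False by (metis less_ereal.simps(1) max_less_iff_conj not_le)
  qed
  then have "{z\<in>D. truncate_at c \<phi> z < a} = {z\<in>D. \<phi> z < ereal a}" by auto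
  moreover have "openin (top_of_set D) {z\<in>D. \<phi> z < ereal a}"
    using assms by (auto simp: plurisubharmonic_on_def)
  ultimately show ?thesis using assms(2) by (metis openin_open_eq)
qed

section \<open>A maximum principle along preimages of complex lines\<close>

text \<open>Without a maximum, the open sets on which \<open>F\<close> stays below some value
  \<open>F y\<close> would cover \<open>S\<close>. In a finite subcover the point with the largest
  value would itself lie below another of these values.\<close>

lemma usc_attains_max:
  fixes F :: "'a::topological_space \<Rightarrow> real"
  assumes "compact S" "S \<noteq> {}"
    and usc: "\<And>c x. x \<in> S \<Longrightarrow> F x < c \<Longrightarrow> \<exists>W. open W \<and> x \<in> W \<and> (\<forall>y\<in>W \<inter> S. F y < c)"
  obtains x where "x \<in> S" "\<And>y. y \<in> S \<Longrightarrow> F y \<le> F x"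
proof (rule ccontr)
  assume "\<not> thesis"
  then have *: "\<forall>x\<in>S. \<exists>y\<in>S. F x < F y" using that by (meson not_le)
  define T where "T y = \<Union>{W. open W \<and> (\<forall>x\<in>W \<inter> S. F x < F y)}" for y
  have "S \<subseteq> \<Union>(T ` S)"
  proof
    fix x assume x: "x \<in> S"
    then obtain y where "y \<in> S" "F x < F y" using * by auto
    with usc[OF x, of "F y"] show "x \<in> \<Union>(T ` S)" unfolding T_def by blast
  qed
  moreover have "open (T y)" for y unfolding T_def by auto
  ultimately obtain C where C: "C \<subseteq> S" "finite C" "S \<subseteq> \<Union>(T ` C)"
    using compactE_image[OF assms(1), of S T] by metis
  have "C \<noteq> {}" using C assms(2) by auto
  then have "Max (F ` C) \<in> F ` C" using C(2) by (intro Max_in) auto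
  then obtain y where y0: "y \<in> C" "F y = Max (F ` C)" by (metis imageE)
  have y: "F x \<le> F y" if "x \<in> C" for x using C(2) that y0 by (simp add: y0)
  then obtain x where "x \<in> C" "y \<in> T x" using C y0(1) by blast
  then have "F y < F x" using C(1) y0(1) unfolding T_def by blast
  then show False using y \<open>x \<in> C\<close> by force
qed

lemma norm_scalar_mult_vec: "norm (c *s v) = norm c * norm (v :: complex^'n)"
  unfolding norm_vec_def L2_set_def
  by (simp add: norm_mult power_mult_distrib flip: sum_distrib_left) (simp add: real_sqrt_mult)

lemma bounded_linear_scalar_mult_vec_left: "bounded_linear (\<lambda>c. c *s (v :: complex^'n))"
  by (rule bounded_linear_intro[of _ "norm v"])
     (auto simp: norm_scalar_mult_vec vec_eq_iff algebra_simps)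

text \<open>In this form the real inner product can enter a holomorphic majorant in
  \<open>\<zeta>\<close>.\<close>

lemma inner_scalar_mult_vec: "a \<bullet> (\<zeta> *s v) = Re (\<zeta> * (\<Sum>i\<in>UNIV. cnj (a $ i) * v $ i))"
  for a v :: "complex^'n"
  by (simp add: inner_vec_def inner_complex_def sum_distrib_left algebra_simps flip: sum.distrib sum_subtractf)

lemma norm_add_sqr: "(norm (a + c))\<^sup>2 = (norm a)\<^sup>2 + 2 * (a \<bullet> c) + (norm c)\<^sup>2" for a c :: "'a::real_inner"
  by (simp add: power2_norm_eq_inner algebra_simps inner_commute)

lemma holomorphic_on_line_component:
  fixes f :: "complex^'n \<Rightarrow> complex^'m"
  assumes "holomorphic_map_on f D" "\<And>\<zeta>. \<zeta> \<in> T \<Longrightarrow> z + \<zeta> *s v \<in> D"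
  shows "(\<lambda>\<zeta>. f (z + \<zeta> *s v) $ i) holomorphic_on T"
  unfolding holomorphic_on_def
proof
  fix \<zeta> assume "\<zeta> \<in> T"
  then obtain f' where f': "(f has_derivative f') (at (z + \<zeta> *s v))"
    and lin: "\<And>c w. f' (c *s w) = c *s f' w"
    using assms by (meson holomorphic_map_on_def)
  have "((\<lambda>\<zeta>. z + \<zeta> *s v) has_derivative (\<lambda>h. h *s v)) (at \<zeta>)"
    using has_derivative_add[OF has_derivative_const
        bounded_linear_imp_has_derivative[OF bounded_linear_scalar_mult_vec_left]] by simp
  from has_derivative_compose[OF this f']
  have "((\<lambda>\<zeta>. f (z + \<zeta> *s v)) has_derivative (\<lambda>h. f' (h *s v))) (at \<zeta>)" .
  from bounded_linear.has_derivative[OF bounded_linear_vec_nth[of i] this]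
  have "((\<lambda>\<zeta>. f (z + \<zeta> *s v) $ i) has_derivative (\<lambda>h. f' v $ i * h)) (at \<zeta>)"
    by (simp add: lin mult.commute)
  then have "((\<lambda>\<zeta>. f (z + \<zeta> *s v) $ i) has_field_derivative f' v $ i) (at \<zeta>)"
    by (simp add: has_field_derivative_def)
  then show "(\<lambda>\<zeta>. f (z + \<zeta> *s v) $ i) field_differentiable at \<zeta> within T"
    by (meson field_differentiable_at_within field_differentiable_def)
qed

text \<open>The pairs \<open>(v, \<mu>)\<close> form a space of larger dimension than the target, so
  the linear map \<open>f' v - \<mu> *s b\<close> has a nontrivial kernel.\<close>

lemma exists_tangent_direction:
  fixes f' :: "complex^'n \<Rightarrow> complex^'n"
  assumes "linear f'"
  obtains v \<mu> where "(v, \<mu>) \<noteq> (0, 0)" "f' v = \<mu> *s b"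
proof -
  let ?L = "\<lambda>(v, \<mu>). f' v - \<mu> *s b"
  have "linear (\<lambda>x::(complex^'n) \<times> complex. f' (fst x) - snd x *s b)"
    using linear_add[OF assms] linear_scale[OF assms]
    by (intro linearI) (auto simp: vec_eq_iff algebra_simps)
  then have lin: "linear ?L" by (simp add: case_prod_beta')
  have "\<not> inj ?L"
  proof
    assume "inj ?L"
    then have "dim (range ?L) = dim (UNIV :: ((complex^'n) \<times> complex) set)"
      by (intro dim_image_eq[OF lin]) auto
    moreover have "dim (range ?L) \<le> DIM(complex^'n)" by (rule dim_subset_UNIV)
    ultimately show False by (simp add: dim_UNIV)
  qed
  then obtain x where "?L x = 0" "x \<noteq> 0" using linear_injective_0[OF lin] by blast
  then show ?thesis using that[of "fst x" "snd x"] by (auto simp: case_prod_beta' zero_prod_def)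
qed

text \<open>Moving in a direction tangent to the set \<^term>\<open>f z = \<xi> *s b\<close>, the penalty term changes only to
  second order up to the real part of a holomorphic function, while the two squared norms
  contribute a strictly positive mean. Such a direction exists even where the derivative of
  \<^term>\<open>f\<close> is singular.\<close>
lemma no_interior_penalized_max:
  fixes f :: "complex^'n \<Rightarrow> complex^'n" and p b :: "complex^'n"
  assumes holo: "holomorphic_map_on f D"
    and sub: "line_subharmonic_on u D"
    and W: "open W" "W \<subseteq> D" "z \<in> W" and Y: "open Y" "\<xi> \<in> Y"
    and G: "r > 0" "G holomorphic_on ball 0 r" "G 0 = 0"
      "\<And>\<zeta>. \<zeta> \<in> ball 0 r \<Longrightarrow> q (\<xi> + \<zeta>) = q \<xi> + Re (G \<zeta>)"
    and \<kappa>: "\<kappa>\<^sub>1 > 0" "\<kappa>\<^sub>2 > 0" "K \<ge> 0"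
  defines "F \<equiv> \<lambda>y t. u y + \<kappa>\<^sub>1 * (norm (y - p))\<^sup>2 + \<kappa>\<^sub>2 * (norm t)\<^sup>2 - q t - K * (norm (f y - t *s b))\<^sup>2"
  assumes max: "\<And>y t. y \<in> W \<Longrightarrow> t \<in> Y \<Longrightarrow> F y t \<le> F z \<xi>"
  shows False
proof -
  obtain f' where f': "(f has_derivative f') (at z)" and flin: "\<And>c w. f' (c *s w) = c *s f' w"
    using holo W by (meson holomorphic_map_on_def subsetD)
  have "linear f'" using f' by (rule has_derivative_linear)
  then obtain v \<mu> where v\<mu>: "(v, \<mu>) \<noteq> (0, 0)" and fv: "f' v = \<mu> *s b"
    by (rule exists_tangent_direction)
  \<comment> \<open>Averaged over the circle of radius \<open>\<rho>\<close> in the tangent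
    direction, the two squared norms gain \<open>\<rho>\<^sup>2 * s\<close>.\<close>
  define s where "s = \<kappa>\<^sub>1 * (norm v)\<^sup>2 + \<kappa>\<^sub>2 * (norm \<mu>)\<^sup>2"
  have s: "s > 0"
  proof (cases "v = 0")
    case True then show ?thesis using v\<mu> \<kappa> by (simp add: s_def)
  next
    case False then show ?thesis using \<kappa> unfolding s_def by (intro add_pos_nonneg) auto
  qed
  \<comment> \<open>The remainder of \<open>f\<close> will be at most \<open>\<epsilon>\<close>
    times the step, so that its square costs the penalty
    \<open>K * (\<epsilon> * norm v)\<^sup>2\<close> per unit of \<open>\<rho>\<^sup>2\<close>. This
    choice keeps the cost below \<open>s\<close>.\<close>
  define \<epsilon> where "\<epsilon> = sqrt (s / (K * (norm v)\<^sup>2 + 1))"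
  have den: "K * (norm v)\<^sup>2 + 1 > 0" using \<kappa> by (simp add: add_nonneg_pos)
  have \<epsilon>: "\<epsilon> > 0" using s den by (simp add: \<epsilon>_def)
  have \<epsilon>2: "\<epsilon>\<^sup>2 = s / (K * (norm v)\<^sup>2 + 1)" using s den by (simp add: \<epsilon>_def)
  have K\<epsilon>: "K * (\<epsilon> * norm v)\<^sup>2 < s"
    unfolding power_mult_distrib \<epsilon>2 using s den by (simp add: field_simps)
  define w where "w = f z - \<xi> *s b"
  \<comment> \<open>Since \<open>f' v = \<mu> *s b\<close>, the linear terms cancel: the vector in
    the penalty is \<open>w + e \<zeta>\<close>, where \<open>e\<close> is the remainder of
    \<open>f\<close> at \<open>z\<close>.\<close>
  define e where "e = (\<lambda>\<zeta> :: complex. f (z + \<zeta> *s v) - (\<xi> + \<zeta> * \<mu>) *s b - w)"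
  obtain d where d: "d > 0" "\<And>y. norm (y - z) < d \<Longrightarrow> norm (f y - f z - f' (y - z)) \<le> \<epsilon> * norm (y - z)"
    using f' \<epsilon> unfolding has_derivative_at_alt by blast
  have e_le: "norm (e \<zeta>) \<le> norm \<zeta> * (\<epsilon> * norm v)" if "norm \<zeta> * norm v < d" for \<zeta>
  proof -
    have "e \<zeta> = f (z + \<zeta> *s v) - f z - f' (\<zeta> *s v)"
      by (simp add: e_def w_def flin fv algebra_simps vec_eq_iff)
    then show ?thesis using d(2)[of "z + \<zeta> *s v"] that by (simp add: norm_scalar_mult_vec mult_ac)
  qed
  obtain d1 where d1: "d1 > 0" "ball z d1 \<subseteq> W" using W by (meson openE)
  obtain d2 where d2: "d2 > 0" "ball \<xi> d2 \<subseteq> Y" using Y by (meson openE)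
  define d0 where "d0 = min (min d d1) (min d2 r)"
  have d0: "d0 > 0" "d0 \<le> d" "d0 \<le> d1" "d0 \<le> d2" "d0 \<le> r"
    using d d1 d2 G(1) by (auto simp: d0_def)
  define \<rho> where "\<rho> = d0 / (2 * (1 + norm v + norm \<mu>))"
  have \<rho>: "\<rho> > 0" using d0 by (auto simp: \<rho>_def intro!: divide_pos_pos add_pos_nonneg)
  have "\<rho> * (1 + norm v + norm \<mu>) < d0"
  proof -
    have "1 + norm v + norm \<mu> > 0" by (auto intro!: add_pos_nonneg)
    moreover have "d0 / (2 * x) * x = d0 / 2" if "x > 0" for x using that by simp
    ultimately have "\<rho> * (1 + norm v + norm \<mu>) = d0 / 2" unfolding \<rho>_def by blast
    then show ?thesis using d0 by simp
  qed
  moreover have nonneg: "\<rho> * norm v \<ge> 0" "\<rho> * norm \<mu> \<ge> 0" using \<rho> by auto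
  ultimately have "\<rho> + \<rho> * norm v + \<rho> * norm \<mu> < d0" by (simp add: distrib_left)
  then have \<rho>v: "\<rho> * norm v < d0" and \<rho>\<mu>: "\<rho> * norm \<mu> < d0"
    using \<rho> nonneg by linarith+
  have small: "norm (complex_of_real \<rho> * \<zeta>) * x \<le> \<rho> * x" if "norm \<zeta> \<le> 1" "x \<ge> 0" for \<zeta> :: complex and x
    using that \<rho> by (simp add: norm_mult mult_right_mono mult_left_le)
  have zW: "z + (\<rho> * \<zeta>) *s v \<in> W" if "norm \<zeta> \<le> 1" for \<zeta> :: complex
    using small[OF that, of "norm v"] \<rho>v d0 d1
    by (intro subsetD[OF d1(2)]) (auto simp: dist_norm norm_scalar_mult_vec)
  have \<xi>Y: "\<xi> + \<rho> * \<zeta> * \<mu> \<in> Y" if "norm \<zeta> \<le> 1" for \<zeta> :: complex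
    using small[OF that, of "norm \<mu>"] \<rho>\<mu> d0 d2
    by (intro subsetD[OF d2(2)]) (auto simp: dist_norm norm_mult)
  have \<mu>r: "\<rho> * \<zeta> * \<mu> \<in> ball 0 r" if "norm \<zeta> \<le> 1" for \<zeta> :: complex
    using small[OF that, of "norm \<mu>"] \<rho>\<mu> d0 by (auto simp: norm_mult)
  \<comment> \<open>Solving the maximality inequality for \<open>u\<close> and expanding the squares
    bounds \<open>u\<close> on the circle by the real part of the holomorphic function
    \<open>Gh\<close>. The quadratic terms go into the constant \<open>c\<close>, which is smaller
    than \<open>u z\<close>.\<close>
  define c where "c = u z - \<rho>\<^sup>2 * (s - K * (\<epsilon> * norm v)\<^sup>2)"
  define Gh where "Gh = (\<lambda>\<zeta> :: complex. complex_of_real c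
      - 2 * \<kappa>\<^sub>1 * (\<rho> * \<zeta> * (\<Sum>i\<in>UNIV. cnj ((z - p) $ i) * v $ i))
      - 2 * \<kappa>\<^sub>2 * (cnj \<xi> * (\<rho> * \<zeta> * \<mu>))
      + G (\<rho> * \<zeta> * \<mu>)
      + 2 * K * (\<Sum>i\<in>UNIV. cnj (w $ i) * (f (z + \<zeta> *s (complex_of_real \<rho> *s v)) $ i
                                     - ((\<xi> + \<rho> * \<zeta> * \<mu>) * b $ i) - w $ i)))"
  have sm: "\<zeta> *s (complex_of_real \<rho> *s v) = (\<rho> * \<zeta>) *s v" for \<zeta> :: complex
    by (simp add: vec_eq_iff mult_ac)
  have hol: "Gh holomorphic_on cball 0 1"
    unfolding Gh_def
  proof (intro holomorphic_intros)
    have "G \<circ> (\<lambda>\<zeta>. \<rho> * \<zeta> * \<mu>) holomorphic_on cball 0 1"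
      by (rule holomorphic_on_compose_gen[OF _ G(2)]) (use \<mu>r in \<open>auto intro!: holomorphic_intros\<close>)
    then show "(\<lambda>\<zeta>. G (\<rho> * \<zeta> * \<mu>)) holomorphic_on cball 0 1" by (simp add: o_def)
    show "(\<lambda>\<zeta>. f (z + \<zeta> *s (complex_of_real \<rho> *s v)) $ i) holomorphic_on cball 0 1" for i
      by (rule holomorphic_on_line_component[OF holo]) (unfold sm, use zW W in auto)
  qed
  have Gh0: "Gh 0 = complex_of_real c"
    by (simp add: Gh_def G w_def)
  have maj: "u (z + (\<rho> * \<zeta>) *s v) \<le> Re (Gh \<zeta>)" if \<zeta>: "norm \<zeta> = 1" for \<zeta> :: complex
  proof -
    let ?\<zeta> = "complex_of_real \<rho> * \<zeta>"
    have n: "norm ?\<zeta> = \<rho>" using \<zeta> \<rho> by (simp add: norm_mult)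
    have "F (z + ?\<zeta> *s v) (\<xi> + ?\<zeta> * \<mu>) \<le> F z \<xi>" using max zW \<xi>Y \<zeta> by auto
    then have 0: "u (z + ?\<zeta> *s v) \<le> u z + \<kappa>\<^sub>1 * (norm (z - p))\<^sup>2 + \<kappa>\<^sub>2 * (norm \<xi>)\<^sup>2 - q \<xi> - K * (norm w)\<^sup>2
       - \<kappa>\<^sub>1 * (norm (z + ?\<zeta> *s v - p))\<^sup>2 - \<kappa>\<^sub>2 * (norm (\<xi> + ?\<zeta> * \<mu>))\<^sup>2 + q (\<xi> + ?\<zeta> * \<mu>)
       + K * (norm (f (z + ?\<zeta> *s v) - (\<xi> + ?\<zeta> * \<mu>) *s b))\<^sup>2"
      by (simp add: F_def w_def)
    have 1: "(norm (z + ?\<zeta> *s v - p))\<^sup>2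
        = (norm (z - p))\<^sup>2 + 2 * Re (?\<zeta> * (\<Sum>i\<in>UNIV. cnj ((z - p) $ i) * v $ i)) + \<rho>\<^sup>2 * (norm v)\<^sup>2"
    proof -
      have "z + ?\<zeta> *s v - p = (z - p) + ?\<zeta> *s v" by simp
      then show ?thesis
        by (simp only: norm_add_sqr inner_scalar_mult_vec) (simp add: norm_scalar_mult_vec n power_mult_distrib)
    qed
    have 2: "(norm (\<xi> + ?\<zeta> * \<mu>))\<^sup>2 = (norm \<xi>)\<^sup>2 + 2 * Re (cnj \<xi> * (?\<zeta> * \<mu>)) + \<rho>\<^sup>2 * (norm \<mu>)\<^sup>2"
    proof -
      have "\<xi> \<bullet> (?\<zeta> * \<mu>) = Re (cnj \<xi> * (?\<zeta> * \<mu>))" by (simp add: inner_complex_def)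
      moreover have "norm (?\<zeta> * \<mu>) = \<rho> * norm \<mu>" using n by (simp only: norm_mult)
      ultimately show ?thesis by (simp only: norm_add_sqr power_mult_distrib)
    qed
    have 3: "q (\<xi> + ?\<zeta> * \<mu>) = q \<xi> + Re (G (?\<zeta> * \<mu>))" using G(4) \<mu>r \<zeta> by auto
    have 4: "(norm (f (z + ?\<zeta> *s v) - (\<xi> + ?\<zeta> * \<mu>) *s b))\<^sup>2
        \<le> (norm w)\<^sup>2 + 2 * Re (\<Sum>i\<in>UNIV. cnj (w $ i) * e ?\<zeta> $ i) + \<rho>\<^sup>2 * (\<epsilon> * norm v)\<^sup>2"
    proof -
      have "norm (e ?\<zeta>) \<le> \<rho> * (\<epsilon> * norm v)" using e_le[of ?\<zeta>] \<rho>v d0 n by simp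
      then have "(norm (e ?\<zeta>))\<^sup>2 \<le> (\<rho> * (\<epsilon> * norm v))\<^sup>2" by (rule power_mono) simp
      moreover have "f (z + ?\<zeta> *s v) - (\<xi> + ?\<zeta> * \<mu>) *s b = w + e ?\<zeta>" by (simp add: e_def)
      moreover have "w \<bullet> e ?\<zeta> = Re (\<Sum>i\<in>UNIV. cnj (w $ i) * e ?\<zeta> $ i)"
        using inner_scalar_mult_vec[of w 1 "e ?\<zeta>"] by simp
      ultimately show ?thesis by (simp add: norm_add_sqr power_mult_distrib)
    qed
    have 5: "Re (Gh \<zeta>) = c - 2 * \<kappa>\<^sub>1 * Re (?\<zeta> * (\<Sum>i\<in>UNIV. cnj ((z - p) $ i) * v $ i))
       - 2 * \<kappa>\<^sub>2 * Re (cnj \<xi> * (?\<zeta> * \<mu>)) + Re (G (?\<zeta> * \<mu>))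
       + 2 * K * Re (\<Sum>i\<in>UNIV. cnj (w $ i) * e ?\<zeta> $ i)"
    proof -
      have re: "Re (complex_of_real x * y) = x * Re y" for x y by simp
      show ?thesis unfolding Gh_def sm e_def by (simp only: minus_complex.sel plus_complex.sel re Re_complex_of_real vector_minus_component vector_smult_component)
    qed
    \<comment> \<open>The bookkeeping with norms and inner products abstracted to real variables.
      Its premises are maximality, the bound on the penalty and the value of
      \<open>c\<close>.\<close>
    have collect: "x \<le> d - 2 * k * A - 2 * l * B + g + 2 * k' * E"
      if "x \<le> x0 + k * P + l * L - q0 - k' * w0 - k * (P + 2 * A + m * V) - l * (L + 2 * B + m * M)
              + (q0 + g) + k' * h"
        and "k' * h \<le> k' * (w0 + 2 * E + m * E')" and "d = x0 - m * (k * V + l * M - k' * E')"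
      for x d k A l B g k' E x0 P L q0 w0 m V M h E' :: real
      using that by (simp add: algebra_simps)
    show ?thesis
      unfolding 5 by (rule collect[OF 0[unfolded 1 2 3] mult_left_mono[OF 4 \<kappa>(3)]])
        (simp only: c_def s_def)
  qed
  have "u z \<le> Re (Gh 0)"
  proof (rule sub[unfolded line_subharmonic_on_def, rule_format, OF hol])
    fix \<zeta> :: complex
    show "\<zeta> \<in> cball 0 1 \<Longrightarrow> z + \<zeta> *s (complex_of_real \<rho> *s v) \<in> D"
      unfolding sm using zW W by auto
    show "\<zeta> \<in> sphere 0 1 \<Longrightarrow> u (z + \<zeta> *s (complex_of_real \<rho> *s v)) \<le> Re (Gh \<zeta>)"
      unfolding sm using maj by auto
  qed
  then have "\<rho>\<^sup>2 * (s - K * (\<epsilon> * norm v)\<^sup>2) \<le> 0" by (simp add: Gh0 c_def)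
  moreover have "\<rho>\<^sup>2 * (s - K * (\<epsilon> * norm v)\<^sup>2) > 0" using \<rho> K\<epsilon> by simp
  ultimately show False by simp
qed

lemma usc_add_continuous:
  fixes u :: "'a::topological_space \<Rightarrow> real" and R :: "'a \<times> 'b::topological_space \<Rightarrow> real"
  assumes usc: "\<And>a. open {z\<in>D. u z < a}" and "S \<subseteq> D" and R: "continuous_on (S \<times> X) R"
    and x: "x \<in> S \<times> X" "u (fst x) + R x < c"
  shows "\<exists>W. open W \<and> x \<in> W \<and> (\<forall>y\<in>W \<inter> (S \<times> X). u (fst y) + R y < c)"
proof -
  \<comment> \<open>The midpoint between \<open>u (fst x)\<close> and \<open>c - R x\<close> divides
    the available room between the two summands.\<close>
  define a where "a = (u (fst x) + (c - R x)) / 2"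
  have a: "u (fst x) < a" "R x < c - a" using x by (auto simp: a_def field_simps)
  obtain V where V: "open V" "V \<inter> (S \<times> X) = R -` {..<c - a} \<inter> (S \<times> X)"
    using continuous_on_open_invariant[THEN iffD1, OF R, rule_format, of "{..<c - a}"] by auto
  let ?W = "({z\<in>D. u z < a} \<times> UNIV) \<inter> V"
  have "open ?W" using usc V by (intro open_Int open_Times) auto
  moreover have "x \<in> V" using V(2) a x by blast
  then have "x \<in> ?W" using a x \<open>S \<subseteq> D\<close> by (cases x) auto
  moreover have "u (fst y) + R y < c" if "y \<in> ?W \<inter> (S \<times> X)" for y
  proof -
    have "R y < c - a" using that V(2) by blast
    moreover have "u (fst y) < a" using that by (cases y) auto
    ultimately show ?thesis by simp
  qed
  ultimately show ?thesis by blast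
qed

lemma compact_usc_superlevel:
  fixes F :: "'a::topological_space \<Rightarrow> real"
  assumes "compact S"
    and usc: "\<And>c x. x \<in> S \<Longrightarrow> F x < c \<Longrightarrow> \<exists>W. open W \<and> x \<in> W \<and> (\<forall>y\<in>W \<inter> S. F y < c)"
  shows "compact {x\<in>S. m \<le> F x}"
proof -
  let ?O = "\<Union>{W. open W \<and> (\<forall>y\<in>W \<inter> S. F y < m)}"
  have "{x\<in>S. m \<le> F x} = S - ?O"
    using usc[of _ m] by (auto simp: not_le[symmetric])
  then show ?thesis using assms(1) by (auto intro!: compact_diff)
qed

lemma continuous_on_holomorphic_map_on:
  assumes "holomorphic_map_on f D" shows "continuous_on D f"
  using assms unfolding holomorphic_map_on_def
  by (meson continuous_at_imp_continuous_on has_derivative_continuous)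

text \<open>If the inequality fails, the difference of its sides is some \<open>m > 0\<close>. By
  \<open>inner\<close> and \<open>bd\<close>, pairs outside \<open>W \<times> Y\<close> with a
  difference of at least \<open>m\<close> violate \<open>f z = \<xi> *s b\<close> by a fixed amount.
  A large multiple of the squared violation therefore forces the penalized maximum into
  \<open>W \<times> Y\<close>, where \<open>no_interior_penalized_max\<close> excludes it.\<close>

lemma slice_maximum_principle:
  fixes f :: "complex^'n \<Rightarrow> complex^'n" and p b :: "complex^'n"
  assumes holo: "holomorphic_map_on f D"
    and sub: "line_subharmonic_on u D" and usc: "\<And>a. open {z\<in>D. u z < a}"
    and S: "compact S" "S \<subseteq> D" and W: "open W" "W \<subseteq> S"
    and X: "compact X" and Y: "open Y" "Y \<subseteq> X"
    and q: "continuous_on X q"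
    and qharm: "\<And>\<xi>. \<xi> \<in> Y \<Longrightarrow> \<exists>r>0. \<exists>G. G holomorphic_on ball 0 r \<and> G 0 = 0 \<and>
                  (\<forall>\<zeta>\<in>ball 0 r. q (\<xi> + \<zeta>) = q \<xi> + Re (G \<zeta>))"
    and \<kappa>: "\<kappa>\<^sub>1 > 0" "\<kappa>\<^sub>2 > 0"
    and inner: "\<And>z \<xi>. z \<in> S \<Longrightarrow> \<xi> \<in> X \<Longrightarrow> f z = \<xi> *s b \<Longrightarrow> z \<in> W"
    and bd: "\<And>z \<xi>. z \<in> S \<Longrightarrow> \<xi> \<in> X - Y \<Longrightarrow> f z = \<xi> *s b \<Longrightarrow>
                u z + \<kappa>\<^sub>1 * (norm (z - p))\<^sup>2 + \<kappa>\<^sub>2 * (norm \<xi>)\<^sup>2 \<le> q \<xi>"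
    and z0: "z\<^sub>0 \<in> S" "\<xi>\<^sub>0 \<in> X" "f z\<^sub>0 = \<xi>\<^sub>0 *s b"
  shows "u z\<^sub>0 + \<kappa>\<^sub>1 * (norm (z\<^sub>0 - p))\<^sup>2 + \<kappa>\<^sub>2 * (norm \<xi>\<^sub>0)\<^sup>2 \<le> q \<xi>\<^sub>0"
proof (rule ccontr)
  assume neg: "\<not> ?thesis"
  define R where "R = (\<lambda>(z, \<xi>). \<kappa>\<^sub>1 * (norm (z - p))\<^sup>2 + \<kappa>\<^sub>2 * (norm \<xi>)\<^sup>2 - q \<xi>)"
  define H where "H = (\<lambda>(z, \<xi>). (norm (f z - \<xi> *s b))\<^sup>2)"
  have contf: "continuous_on S f"
    using continuous_on_holomorphic_map_on[OF holo] S continuous_on_subset by blast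
  have contR: "continuous_on (S \<times> X) R"
    unfolding R_def case_prod_beta'
    by (intro continuous_intros continuous_on_compose2[OF q]) auto
  have contH: "continuous_on (S \<times> X) H"
    unfolding H_def case_prod_beta'
    by (intro continuous_intros continuous_on_compose2[OF contf]
          linear_continuous_on_compose[OF _ bounded_linear.linear[OF bounded_linear_scalar_mult_vec_left]]) auto
  define m where "m = u z\<^sub>0 + R (z\<^sub>0, \<xi>\<^sub>0)"
  have m: "m > 0" using neg by (simp add: m_def R_def)
  have SX: "compact (S \<times> X)" "S \<times> X \<noteq> {}" using S X z0 by (auto intro: compact_Times)
  note usc_add = usc_add_continuous[OF usc S(2), of X]
  obtain x1 where x1: "x1 \<in> S \<times> X" "\<And>x. x \<in> S \<times> X \<Longrightarrow> u (fst x) + R x \<le> u (fst x1) + R x1"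
    using usc_attains_max[OF SX, of "\<lambda>x. u (fst x) + R x"] usc_add[OF contR] by metis
  define M where "M = u (fst x1) + R x1"
  have M: "m \<le> M" using x1(2)[of "(z\<^sub>0, \<xi>\<^sub>0)"] z0 by (simp add: m_def M_def)
  define T where "T = {x\<in>S \<times> X. m \<le> u (fst x) + R x} - W \<times> Y"
  have "compact T" unfolding T_def
    by (intro compact_diff compact_usc_superlevel SX usc_add[OF contR] open_Times W Y)
  have H_pos: "H x > 0" if "x \<in> T" for x
  proof (rule ccontr)
    obtain z \<xi> where x: "x = (z, \<xi>)" by force
    assume "\<not> H x > 0"
    then have "f z = \<xi> *s b" by (simp add: H_def x)
    moreover have "z \<in> S" "\<xi> \<in> X" using that by (auto simp: T_def x)
    ultimately have "z \<in> W" "\<xi> \<in> X - Y" using inner that by (auto simp: T_def x)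
    then have "u z + R (z, \<xi>) \<le> 0"
      using bd[OF \<open>z \<in> S\<close> _ \<open>f z = \<xi> *s b\<close>] by (simp add: R_def)
    then show False using that m by (simp add: T_def x)
  qed
  have "\<exists>\<sigma>>0. \<forall>x\<in>T. \<sigma> \<le> H x"
  proof (cases "T = {}")
    case False
    have "continuous_on T H" using contH by (rule continuous_on_subset) (auto simp: T_def)
    then show ?thesis using continuous_attains_inf[OF \<open>compact T\<close> False] H_pos by metis
  qed (auto intro: exI[of _ 1])
  then obtain \<sigma> where \<sigma>: "\<sigma> > 0" "\<And>x. x \<in> T \<Longrightarrow> \<sigma> \<le> H x" by auto
  \<comment> \<open>On \<open>T\<close> the unpenalized value is at most \<open>M\<close> and the
    penalty at least \<open>M - m + 1\<close>. The penalized value there is thus below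
    \<open>m\<close>, its value at the given pair.\<close>
  define K where "K = (M - m + 1) / \<sigma>"
  have K: "K > 0" using M \<sigma> by (simp add: K_def)
  have contRK: "continuous_on (S \<times> X) (\<lambda>x. R x - K * H x)"
    by (intro continuous_intros contR contH)
  obtain x where x: "x \<in> S \<times> X"
    "\<And>y. y \<in> S \<times> X \<Longrightarrow> u (fst y) + (R y - K * H y) \<le> u (fst x) + (R x - K * H x)"
    using usc_attains_max[OF SX, of "\<lambda>x. u (fst x) + (R x - K * H x)"] usc_add[OF contRK] by metis
  have "H (z\<^sub>0, \<xi>\<^sub>0) = 0" using z0 by (simp add: H_def)
  then have ge: "m \<le> u (fst x) + (R x - K * H x)"
    using x(2)[of "(z\<^sub>0, \<xi>\<^sub>0)"] z0 by (simp add: m_def)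
  have "H x \<ge> 0" by (simp add: H_def case_prod_beta')
  then have "K * H x \<ge> 0" using K by simp
  have "x \<notin> T"
  proof
    assume "x \<in> T"
    have "K * \<sigma> \<le> K * H x" using \<sigma>(2)[OF \<open>x \<in> T\<close>] K by simp
    moreover have "K * \<sigma> = M - m + 1" using \<sigma> by (simp add: K_def)
    ultimately show False using ge x1(2)[OF x(1)] by (simp add: M_def)
  qed
  then have WY: "x \<in> W \<times> Y" using x(1) ge \<open>K * H x \<ge> 0\<close> by (auto simp: T_def)
  obtain z \<xi> where x_eq: "x = (z, \<xi>)" by force
  have "z \<in> W" "\<xi> \<in> Y" using WY x_eq by auto
  then obtain r G where G: "r > 0" "G holomorphic_on ball 0 r" "G 0 = 0"
      "\<And>\<zeta>. \<zeta> \<in> ball 0 r \<Longrightarrow> q (\<xi> + \<zeta>) = q \<xi> + Re (G \<zeta>)"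
    using qharm by metis
  show False
  proof (rule no_interior_penalized_max[where z = z and \<xi> = \<xi> and b = b and p = p and K = K,
        OF holo sub W(1) _ \<open>z \<in> W\<close> Y(1) \<open>\<xi> \<in> Y\<close> G \<kappa>])
    show "W \<subseteq> D" using W S by auto
    show "K \<ge> 0" using K by simp
    fix y t assume "y \<in> W" "t \<in> Y"
    then have "(y, t) \<in> S \<times> X" using W Y by auto
    from x(2)[OF this] show "u y + \<kappa>\<^sub>1 * (norm (y - p))\<^sup>2 + \<kappa>\<^sub>2 * (norm t)\<^sup>2 - q t - K * (norm (f y - t *s b))\<^sup>2
       \<le> u z + \<kappa>\<^sub>1 * (norm (z - p))\<^sup>2 + \<kappa>\<^sub>2 * (norm \<xi>)\<^sup>2 - q \<xi> - K * (norm (f z - \<xi> *s b))\<^sup>2"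
      by (simp add: x_eq R_def H_def algebra_simps)
  qed
qed

section \<open>Logarithmic potentials of finite Blaschke products\<close>

text \<open>Near \<open>\<xi>\<close> the quotient \<open>B (\<xi> + \<zeta>) / B \<xi>\<close>
  stays within distance 1 of 1, where \<open>Ln\<close> is holomorphic. Its logarithm serves as
  \<open>G\<close>.\<close>

lemma ln_norm_holomorphic_local:
  assumes B: "B holomorphic_on Y" "open Y" "\<xi> \<in> Y" "B \<xi> \<noteq> 0"
  shows "\<exists>r>0. \<exists>G. G holomorphic_on ball 0 r \<and> G 0 = 0 \<and>
           (\<forall>\<zeta>\<in>ball 0 r. ln (norm (B (\<xi> + \<zeta>))) = ln (norm (B \<xi>)) + Re (G \<zeta>))"
proof -
  obtain d where d: "d > 0" "ball \<xi> d \<subseteq> Y" using B by (meson openE)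
  have "continuous_on Y B" using B(1) by (rule holomorphic_on_imp_continuous_on)
  then have "isCont B \<xi>" using B by (simp add: continuous_on_eq_continuous_at)
  then obtain d' where d': "d' > 0" "\<And>x. dist x \<xi> < d' \<Longrightarrow> dist (B x) (B \<xi>) < norm (B \<xi>)"
    using B(4) unfolding continuous_at_eps_delta by (metis zero_less_norm_iff)
  define r where "r = min d d'"
  define Q where "Q = (\<lambda>\<zeta>. B (\<xi> + \<zeta>) / B \<xi>)"
  have Q: "norm (Q \<zeta> - 1) < 1" if "\<zeta> \<in> ball 0 r" for \<zeta>
  proof -
    have "dist (B (\<xi> + \<zeta>)) (B \<xi>) < norm (B \<xi>)" using d'(2) that by (auto simp: r_def dist_norm)
    moreover have "Q \<zeta> - 1 = (B (\<xi> + \<zeta>) - B \<xi>) / B \<xi>" using B(4) by (simp add: Q_def field_simps)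
    ultimately show ?thesis using B(4) by (simp add: norm_divide dist_norm)
  qed
  have Re_Q: "Re (Q \<zeta>) > 0" if "\<zeta> \<in> ball 0 r" for \<zeta>
    using Q[OF that] abs_Re_le_cmod[of "Q \<zeta> - 1"] by auto
  have "Q holomorphic_on ball 0 r"
  proof -
    have "B \<circ> (\<lambda>\<zeta>. \<xi> + \<zeta>) holomorphic_on ball 0 r"
      by (rule holomorphic_on_compose_gen[OF _ B(1)])
         (use d in \<open>auto intro!: holomorphic_intros simp: r_def dist_norm subset_iff\<close>)
    then show ?thesis using B(4) unfolding Q_def o_def by (intro holomorphic_intros) auto
  qed
  then have "(\<lambda>\<zeta>. Ln (Q \<zeta>)) holomorphic_on ball 0 r"
    using Re_Q by (intro holomorphic_intros) (auto simp: complex_nonpos_Reals_iff dest: leD)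
  moreover have "ln (norm (B (\<xi> + \<zeta>))) = ln (norm (B \<xi>)) + Re (Ln (Q \<zeta>))" if "\<zeta> \<in> ball 0 r" for \<zeta>
  proof -
    have "Q \<zeta> \<noteq> 0" using Re_Q[OF that] by auto
    moreover have "B (\<xi> + \<zeta>) = B \<xi> * Q \<zeta>" using B(4) by (simp add: Q_def)
    ultimately show ?thesis using B(4) by (simp add: norm_mult ln_mult)
  qed
  moreover have "Ln (Q 0) = 0" using B(4) by (simp add: Q_def)
  moreover have "r > 0" using d d' by (simp add: r_def)
  ultimately show ?thesis by blast
qed

text \<open>Passing from \<open>N\<close> to \<open>Suc N\<close> adds
  \<open>ln (1 + 1 / N)\<close>, at most \<open>1 / N\<close>, to each of \<open>N\<close> terms,
  and the new term is \<open>ln 1\<close>. This is a weak form of Stirling's formula.\<close>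

lemma sum_ln_quotient_le: "(\<Sum>i=1..N. ln (real N / real i)) \<le> real N"
proof (induction N)
  case (Suc N)
  show ?case
  proof (cases "N = 0")
    case False
    have "(\<Sum>i=1..Suc N. ln (real (Suc N) / real i)) = (\<Sum>i=1..N. ln (real (Suc N) / real i))" by simp
    also have "\<dots> = (\<Sum>i=1..N. ln (real N / real i) + ln (1 + 1 / real N))"
    proof (rule sum.cong)
      fix i assume "i \<in> {1..N}"
      then have "real (Suc N) / real i = real N / real i * (1 + 1 / real N)"
        using False by (simp add: field_simps)
      then show "ln (real (Suc N) / real i) = ln (real N / real i) + ln (1 + 1 / real N)"
        using False \<open>i \<in> {1..N}\<close> by (subst ln_mult_pos[symmetric]) (auto simp: add_pos_pos)
    qed simp
    also have "\<dots> = (\<Sum>i=1..N. ln (real N / real i)) + real N * ln (1 + 1 / real N)"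
      by (simp add: sum.distrib)
    also have "\<dots> \<le> real N + real N * (1 / real N)"
      using Suc False by (intro add_mono mult_left_mono ln_add_one_self_le_self) auto
    finally show ?thesis using False by simp
  qed simp
qed simp

text \<open>Rounding \<open>x\<close> gives an integer within 1/2 of it, and any other integer is at
  least 1 away from that one. The cap is \<open>N + 1\<close> rather than \<open>N\<close>, so that
  no index is excluded when \<open>x\<close> lies far beyond \<open>N\<close>.\<close>

lemma exists_nearest_index:
  fixes x :: real
  assumes "x \<ge> 0"
  obtains m where "m \<le> N + 1" "\<And>j. j \<in> {1..N} \<Longrightarrow> j \<noteq> m \<Longrightarrow> \<bar>real j - real m\<bar> / 2 \<le> \<bar>x - real j\<bar>"
proof
  define k where "k = nat (round x)"
  have "round x \<ge> 0" using assms by (simp add: round_def)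
  then have k: "\<bar>real k - x\<bar> \<le> 1 / 2" using of_int_round_abs_le[of x] by (simp add: k_def)
  show "min k (N + 1) \<le> N + 1" by simp
  fix j assume j: "j \<in> {1..N}" "j \<noteq> min k (N + 1)"
  show "\<bar>real j - real (min k (N + 1))\<bar> / 2 \<le> \<bar>x - real j\<bar>"
  proof (cases "k \<le> N + 1")
    case True
    then have "real j + 1 \<le> real k \<or> real k + 1 \<le> real j" using j by auto
    then have "\<bar>real j - real k\<bar> / 2 \<le> \<bar>x - real j\<bar>"
      using k by (smt (verit) field_sum_of_halves)
    then show ?thesis using True by (simp add: min_def)
  next
    case False
    then have "real k \<ge> real N + 2" "real j \<le> real N" using j by auto
    then have "\<bar>real j - (real N + 1)\<bar> / 2 \<le> \<bar>x - real j\<bar>"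
      using k by (smt (verit) field_sum_of_halves)
    then show ?thesis using False by (simp add: min_def)
  qed
qed

text \<open>Each distance occurs at most once on either side of \<open>m\<close>, and
  \<open>m \<le> N + 1\<close> keeps all distances within \<open>{1..N}\<close>.\<close>

lemma sum_distance_le:
  fixes g :: "nat \<Rightarrow> real"
  assumes g: "\<And>i. i \<in> {1..N} \<Longrightarrow> 0 \<le> g i" and m: "m \<le> N + 1"
  shows "(\<Sum>j\<in>{1..N} - {m}. g (nat \<bar>int j - int m\<bar>)) \<le> 2 * (\<Sum>i=1..N. g i)"
proof -
  let ?L = "{j\<in>{1..N}. j < m}" and ?R = "{j\<in>{1..N}. m < j}"
  have split: "{1..N} - {m} = ?L \<union> ?R" by auto
  have "(\<Sum>j\<in>{1..N} - {m}. g (nat \<bar>int j - int m\<bar>))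
      = (\<Sum>j\<in>?L. g (nat \<bar>int j - int m\<bar>)) + (\<Sum>j\<in>?R. g (nat \<bar>int j - int m\<bar>))"
    unfolding split by (rule sum.union_disjoint) auto
  also have "(\<Sum>j\<in>?L. g (nat \<bar>int j - int m\<bar>)) = (\<Sum>i\<in>(\<lambda>j. m - j) ` ?L. g i)"
    by (subst sum.reindex) (auto simp: inj_on_def intro!: sum.cong arg_cong[where f = g])
  also have "(\<Sum>i\<in>(\<lambda>j. m - j) ` ?L. g i) \<le> (\<Sum>i=1..N. g i)"
    by (rule sum_mono2) (use g m in auto)
  also have "(\<Sum>j\<in>?R. g (nat \<bar>int j - int m\<bar>)) = (\<Sum>i\<in>(\<lambda>j. j - m) ` ?R. g i)"
    by (subst sum.reindex) (auto simp: inj_on_def intro!: sum.cong arg_cong[where f = g])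
  also have "(\<Sum>i\<in>(\<lambda>j. j - m) ` ?R. g i) \<le> (\<Sum>i=1..N. g i)"
    by (rule sum_mono2) (use g m in auto)
  finally show ?thesis by simp
qed

text \<open>The points \<^term>\<open>t j\<close> lie on equidistant circles around \<^term>\<open>a\<close>; their logarithmic potential is
  largest when they lie on one ray. The only term that this comparison does not control
  belongs to the circle nearest to \<^term>\<open>\<xi>\<close>; it is divided out by taking many points.\<close>
lemma log_potential_bound:
  fixes t :: "nat \<Rightarrow> complex"
  assumes N: "N \<ge> 1" and s: "0 < s" "s \<le> 1"
    and t: "\<And>j. j \<in> {1..N} \<Longrightarrow> norm (t j - a) = real j * s / real N"
    and \<eta>: "\<eta> > 0" "ln (2 / \<eta>) \<le> real N" and far: "\<And>j. j \<in> {1..N} \<Longrightarrow> \<eta> \<le> norm (\<xi> - t j)"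
  shows "(\<Sum>j=1..N. ln (2 / norm (\<xi> - t j))) \<le> real N * (3 + 2 * ln (4 / s))"
proof -
  \<comment> \<open>The distance of \<open>\<xi>\<close> from the centre in units of the spacing
    \<open>s / N\<close> of the circles.\<close>
  define x where "x = norm (\<xi> - a) * real N / s"
  have "x \<ge> 0" using s by (simp add: x_def)
  then obtain m where m: "m \<le> N + 1"
    "\<And>j. j \<in> {1..N} \<Longrightarrow> j \<noteq> m \<Longrightarrow> \<bar>real j - real m\<bar> / 2 \<le> \<bar>x - real j\<bar>"
    by (rule exists_nearest_index[of x N]) blast
  \<comment> \<open>A circle \<open>i\<close> indices away from \<open>m\<close> has distance at
    least \<open>i * s / (2 * N)\<close> from \<open>\<xi>\<close>, which bounds its term by
    \<open>g i\<close>.\<close>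
  define g where "g = (\<lambda>i. ln (4 * real N / (s * real i)))"
  have g0: "0 \<le> g i" if "i \<in> {1..N}" for i
  proof -
    have "s * real i \<le> 1 * real N" using that s by (intro mult_mono) auto
    then have "4 * real N / (s * real i) \<ge> 1" using that s by simp
    then show ?thesis unfolding g_def by simp
  qed
  have term_le: "ln (2 / norm (\<xi> - t j)) \<le> g (nat \<bar>int j - int m\<bar>)" if j: "j \<in> {1..N}" "j \<noteq> m" for j
  proof -
    let ?d = "nat \<bar>int j - int m\<bar>"
    have d: "real ?d = \<bar>real j - real m\<bar>" by (simp add: nat_abs_int_diff)
    have d0: "real ?d > 0" using j unfolding d by auto
    have "\<bar>x - real j\<bar> * (s / real N) = \<bar>(x - real j) * (s / real N)\<bar>"
      using s by (simp add: abs_mult)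
    also have "(x - real j) * (s / real N) = norm (\<xi> - a) - norm (t j - a)"
      using s N t[OF j(1)] by (simp add: x_def field_simps)
    also have "\<bar>\<dots>\<bar> \<le> norm (\<xi> - t j)"
      using norm_triangle_ineq3[of "\<xi> - a" "t j - a"] by simp
    finally have "\<bar>x - real j\<bar> * (s / real N) \<le> norm (\<xi> - t j)" .
    moreover have "real ?d / 2 * (s / real N) \<le> \<bar>x - real j\<bar> * (s / real N)"
      using m(2)[OF j] s by (intro mult_right_mono) (auto simp: d)
    ultimately have le: "real ?d * s / (2 * real N) \<le> norm (\<xi> - t j)" by simp
    have pos: "real ?d * s / (2 * real N) > 0" using d0 s N by simp
    then have pos0: "norm (\<xi> - t j) > 0" using le by linarith
    have "2 / norm (\<xi> - t j) \<le> 2 / (real ?d * s / (2 * real N))"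
      by (rule divide_left_mono[OF le _ mult_pos_pos[OF pos0 pos]]) simp
    also have "\<dots> = 4 * real N / (s * real ?d)" by (simp add: mult_ac)
    finally have "2 / norm (\<xi> - t j) \<le> 4 * real N / (s * real ?d)" .
    then show ?thesis unfolding g_def using pos0 by (intro ln_mono) auto
  qed
  \<comment> \<open>The term of index \<open>m\<close>, if present, is at most
    \<open>ln (2 / \<eta>)\<close> and hence at most \<open>N\<close>.\<close>
  have "(\<Sum>j=1..N. ln (2 / norm (\<xi> - t j)))
     \<le> (\<Sum>j\<in>{1..N} - {m}. ln (2 / norm (\<xi> - t j))) + real N"
  proof (cases "m \<in> {1..N}")
    case True
    have pos: "norm (\<xi> - t m) > 0" using far[OF True] \<eta> by linarith
    have "2 / norm (\<xi> - t m) \<le> 2 / \<eta>"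
      using far[OF True] \<eta> pos by (intro divide_left_mono) auto
    then have "ln (2 / norm (\<xi> - t m)) \<le> ln (2 / \<eta>)"
      using pos \<eta> by (subst ln_le_cancel_iff) auto
    then show ?thesis using True \<eta>(2) by (simp add: sum.remove)
  next
    case False
    then have "{1..N} - {m} = {1..N}" by auto
    then show ?thesis by simp
  qed
  also have "(\<Sum>j\<in>{1..N} - {m}. ln (2 / norm (\<xi> - t j)))
      \<le> (\<Sum>j\<in>{1..N} - {m}. g (nat \<bar>int j - int m\<bar>))"
    by (rule sum_mono) (use term_le in auto)
  also have "\<dots> \<le> 2 * (\<Sum>i=1..N. g i)" by (rule sum_distance_le[OF g0 m(1)])
  also have "(\<Sum>i=1..N. g i) = (\<Sum>i=1..N. ln (4 / s) + ln (real N / real i))"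
  proof (rule sum.cong)
    fix i assume "i \<in> {1..N}"
    then show "g i = ln (4 / s) + ln (real N / real i)"
      using s N unfolding g_def by (subst ln_mult_pos[symmetric]) auto
  qed simp
  also have "\<dots> \<le> real N * ln (4 / s) + real N"
    using sum_ln_quotient_le[of N] by (simp add: sum.distrib)
  finally show ?thesis by (simp add: algebra_simps)
qed

definition blaschke_factor :: "complex \<Rightarrow> complex \<Rightarrow> complex" where
  "blaschke_factor t \<xi> = (\<xi> - t) / (1 - cnj t * \<xi>)"

lemma blaschke_denominator:
  assumes "norm t < 1" "norm \<xi> \<le> 1"
  shows "1 - cnj t * \<xi> \<noteq> 0" "norm (1 - cnj t * \<xi>) \<le> 2"
proof -
  have "norm (cnj t * \<xi>) \<le> norm t" using assms by (simp add: norm_mult mult_left_le)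
  then have lt: "norm (cnj t * \<xi>) < 1" using assms by simp
  then show "1 - cnj t * \<xi> \<noteq> 0" by auto
  show "norm (1 - cnj t * \<xi>) \<le> 2" using norm_triangle_ineq4[of 1 "cnj t * \<xi>"] lt by simp
qed

lemma norm_blaschke_factor_circle:
  assumes "norm t < 1" "norm \<xi> = 1"
  shows "norm (blaschke_factor t \<xi>) = 1"
proof -
  have "\<xi> * cnj \<xi> = 1" using assms(2) complex_norm_square[of \<xi>] by simp
  then have "1 - cnj t * \<xi> = \<xi> * cnj (\<xi> - t)" by (simp add: algebra_simps)
  then have "norm (1 - cnj t * \<xi>) = norm (\<xi> - t)" using assms(2) by (simp add: norm_mult del: complex_cnj_diff)
  moreover have "\<xi> \<noteq> t" using assms by auto
  ultimately show ?thesis by (simp add: blaschke_factor_def norm_divide)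
qed

lemma norm_blaschke_factor_ge:
  assumes "norm t < 1" "norm \<xi> \<le> 1"
  shows "norm (\<xi> - t) / 2 \<le> norm (blaschke_factor t \<xi>)"
proof -
  have "norm (1 - cnj t * \<xi>) > 0" using blaschke_denominator(1)[OF assms] by simp
  then show ?thesis
    using divide_left_mono[OF blaschke_denominator(2)[OF assms] norm_ge_zero[of "\<xi> - t"]]
    by (simp add: blaschke_factor_def norm_divide)
qed

lemma holomorphic_on_blaschke_factor:
  "norm t < 1 \<Longrightarrow> blaschke_factor t holomorphic_on cball 0 1"
  unfolding blaschke_factor_def[abs_def]
  by (intro holomorphic_intros) (use blaschke_denominator in auto)

text \<open>The bound per zero in \<open>log_potential_bound\<close>: the nearest circle accounts
  for 1, the circles on either side of it for \<open>1 + ln (4 / s)\<close> each.\<close>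

definition blaschke_bound :: "real \<Rightarrow> real" where
  "blaschke_bound s = 3 + 2 * ln (4 / s)"

lemma blaschke_bound_pos: "0 < s \<Longrightarrow> s \<le> 1 \<Longrightarrow> blaschke_bound s > 0"
  unfolding blaschke_bound_def by (auto intro!: add_pos_nonneg)

text \<open>Each factor is at least half the distance to its zero in modulus, which reduces the
  claim to \<open>log_potential_bound\<close>.\<close>

lemma ln_norm_blaschke_product_ge:
  fixes t :: "nat \<Rightarrow> complex"
  assumes N: "N \<ge> 1" and s: "0 < s" "s \<le> 1"
    and t: "\<And>j. j \<in> {1..N} \<Longrightarrow> norm (t j - a) = real j * s / real N" "\<And>j. j \<in> {1..N} \<Longrightarrow> norm (t j) < 1"
    and \<eta>: "\<eta> > 0" "ln (2 / \<eta>) \<le> real N" and far: "\<And>j. j \<in> {1..N} \<Longrightarrow> \<eta> \<le> norm (\<xi> - t j)"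
    and \<xi>: "norm \<xi> \<le> 1"
  shows "ln (norm (\<Prod>j=1..N. blaschke_factor (t j) \<xi>)) \<ge> - real N * blaschke_bound s"
proof -
  have pos: "norm (\<xi> - t j) > 0" if "j \<in> {1..N}" for j using far[OF that] \<eta>(1) by linarith
  have ge: "norm (\<xi> - t j) / 2 \<le> norm (blaschke_factor (t j) \<xi>)" if "j \<in> {1..N}" for j
    using norm_blaschke_factor_ge[OF t(2)[OF that] \<xi>] .
  have pos': "norm (blaschke_factor (t j) \<xi>) > 0" if "j \<in> {1..N}" for j
    using pos[OF that] ge[OF that] by linarith
  have "ln (norm (\<Prod>j=1..N. blaschke_factor (t j) \<xi>)) = (\<Sum>j=1..N. ln (norm (blaschke_factor (t j) \<xi>)))"
    unfolding prod_norm[symmetric] by (rule ln_prod) (use pos' in auto)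
  moreover have "(\<Sum>j=1..N. ln (norm (blaschke_factor (t j) \<xi>))) \<ge> (\<Sum>j=1..N. - ln (2 / norm (\<xi> - t j)))"
  proof (rule sum_mono)
    fix j assume j: "j \<in> {1..N}"
    have "- ln (2 / norm (\<xi> - t j)) = ln (norm (\<xi> - t j) / 2)"
      using pos[OF j] by (simp add: ln_div)
    also have "\<dots> \<le> ln (norm (blaschke_factor (t j) \<xi>))"
      using pos[OF j] ge[OF j] by (intro ln_mono) auto
    finally show "- ln (2 / norm (\<xi> - t j)) \<le> ln (norm (blaschke_factor (t j) \<xi>))" .
  qed
  ultimately show ?thesis
    using log_potential_bound[OF N s t(1) \<eta> far] by (simp add: sum_negf blaschke_bound_def)
qed

section \<open>Localization near the peak point\<close>

text \<open>Invariance of domain makes the inverse of \<open>f\<close> continuous, so the sublevel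
  set is a continuous image of a closed ball.\<close>

lemma compact_holomorphic_sublevel:
  fixes f :: "complex^'n \<Rightarrow> complex^'n"
  assumes "open D" and holo: "holomorphic_map_on f D" and inj: "inj_on f D" and "cball 0 \<rho> \<subseteq> f ` D"
  obtains g where "continuous_on (cball 0 \<rho>) g" "\<And>w. w \<in> cball 0 \<rho> \<Longrightarrow> g w \<in> D \<and> f (g w) = w"
    "compact {z\<in>D. norm (f z) \<le> \<rho>}" "open {z\<in>D. norm (f z) < \<rho>}"
proof -
  have contf: "continuous_on D f" using holo by (rule continuous_on_holomorphic_map_on)
  obtain g where g: "homeomorphism D (f ` D) f g"
    using invariance_of_domain_homeomorphism[OF \<open>open D\<close> contf _ inj] by auto
  have contg: "continuous_on (cball 0 \<rho>) g"
    using g assms(4) by (auto simp: homeomorphism_def intro: continuous_on_subset)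
  have gw: "g w \<in> D \<and> f (g w) = w" if "w \<in> cball 0 \<rho>" for w
    using g assms(4) that by (auto simp: homeomorphism_def)
  have "{z\<in>D. norm (f z) \<le> \<rho>} = g ` cball 0 \<rho>"
    using gw homeomorphism_apply1[OF g] by (force simp: image_iff)
  then have "compact {z\<in>D. norm (f z) \<le> \<rho>}" using compact_continuous_image[OF contg] by auto
  moreover have "open {z\<in>D. norm (f z) < \<rho>}"
  proof -
    have "{z\<in>D. norm (f z) < \<rho>} = D \<inter> f -` ball 0 \<rho>" by auto
    then show ?thesis using continuous_open_preimage[OF contf \<open>open D\<close> open_ball] by simp
  qed
  ultimately show ?thesis using that contg gw by blast
qed

text \<open>The factor \<^term>\<open>c / blaschke_bound s\<close> scales the logarithm of the Blaschke product to be at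
  least \<^term>\<open>- c\<close> off small discs around its zeros, which lie in the disc of radius
  \<^term>\<open>(1 + \<alpha>) / 2\<close>; half of the resulting value at the origin is spent on the penalty terms.\<close>
definition peak_gap :: "real \<Rightarrow> real \<Rightarrow> real" where
  "peak_gap \<alpha> c = - (c / blaschke_bound ((1 - \<alpha>) / 2)) * ln ((1 + \<alpha>) / 2) / 2"

lemma peak_gap_pos: "0 < \<alpha> \<Longrightarrow> \<alpha> < 1 \<Longrightarrow> 0 < c \<Longrightarrow> 0 < peak_gap \<alpha> c"
proof -
  assume *: "0 < \<alpha>" "\<alpha> < 1" "0 < c"
  then have "c / blaschke_bound ((1 - \<alpha>) / 2) > 0"
    by (intro divide_pos_pos blaschke_bound_pos) auto
  moreover have "ln ((1 + \<alpha>) / 2) < 0" using * by simp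
  ultimately show ?thesis
    unfolding peak_gap_def by (metis half_gt_zero minus_mult_left mult_pos_neg neg_0_less_iff_less)
qed

text \<open>The factors 1, 2, 4 in front of \<^term>\<open>\<delta>\<close> leave room for the penalty terms and for small discs
  around the zeros of the Blaschke product.\<close>
lemma localization:
  fixes f :: "complex^'n \<Rightarrow> complex^'n" and p :: "complex^'n"
  assumes D: "open D" and holo: "holomorphic_map_on f D" and inj: "inj_on f D"
    and \<rho>: "cball 0 \<rho> \<subseteq> f ` D" and psh: "plurisubharmonic_on \<phi> D"
    and neg: "\<And>z. z \<in> D \<Longrightarrow> \<phi> z < 0"
    and c: "c > 0" "\<And>z. z \<in> D \<Longrightarrow> \<delta> \<le> norm (z - p) \<Longrightarrow> \<phi> z \<le> ereal (- c)"
    and \<delta>: "\<delta> > 0" and \<alpha>: "0 < \<alpha>" "\<alpha> < 1"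
    and z0: "z\<^sub>0 \<in> D" "f z\<^sub>0 = 0" "ereal (- min c (peak_gap \<alpha> c)) < \<phi> z\<^sub>0"
    and z1: "z\<^sub>1 \<in> D" "norm (f z\<^sub>1) < \<alpha> * \<rho>"
  shows "norm (z\<^sub>1 - p) < 4 * \<delta>"
proof (rule ccontr)
  assume "\<not> norm (z\<^sub>1 - p) < 4 * \<delta>"
  then have z1_far: "4 * \<delta> \<le> norm (z\<^sub>1 - p)" by simp
  have \<rho>_pos: "\<rho> > 0"
    using z1(2) \<alpha>(1) norm_ge_zero[of "f z\<^sub>1"] by (metis le_less_trans zero_less_mult_pos)
  obtain g where contg: "continuous_on (cball 0 \<rho>) g"
    and g: "\<And>w. w \<in> cball 0 \<rho> \<Longrightarrow> g w \<in> D \<and> f (g w) = w"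
    and S: "compact {z\<in>D. norm (f z) \<le> \<rho>}" and W: "open {z\<in>D. norm (f z) < \<rho>}"
    using compact_holomorphic_sublevel[OF D holo inj \<rho>] by blast
  let ?S = "{z\<in>D. norm (f z) \<le> \<rho>}" and ?W = "{z\<in>D. norm (f z) < \<rho>}"
  \<comment> \<open>Scaled so that \<open>f z\<^sub>1\<close> has parameter \<open>\<alpha>\<close>
    on the line, while the closed unit disc of parameters stays inside the ball of radius
    \<open>\<rho>\<close>.\<close>
  define b where "b = complex_of_real (1 / \<alpha>) *s f z\<^sub>1"
  have b: "norm b < \<rho>"
    using z1(2) \<alpha> by (simp add: b_def norm_scalar_mult_vec norm_divide field_simps)
  have fz1: "f z\<^sub>1 = complex_of_real \<alpha> *s b" using \<alpha> by (simp add: b_def vec_eq_iff)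
  have line_in: "norm (\<xi> *s b) < \<rho>" if "norm \<xi> \<le> 1" for \<xi>
  proof -
    have "norm (\<xi> *s b) \<le> norm b"
      using that by (simp add: norm_scalar_mult_vec mult_left_le_one_le)
    then show ?thesis using b by simp
  qed
  define h where "h = (\<lambda>\<xi>. g (\<xi> *s b))"
  have h: "h \<xi> \<in> D" "f (h \<xi>) = \<xi> *s b" if "norm \<xi> \<le> 1" for \<xi>
    using g[of "\<xi> *s b"] line_in[OF that] by (auto simp: h_def)
  have h_eq: "z = h \<xi>" if "z \<in> D" "norm \<xi> \<le> 1" "f z = \<xi> *s b" for z \<xi>
    using inj_onD[OF inj _ that(1) h(1)[OF that(2)]] h(2)[OF that(2)] that(3) by simp
  have conth: "continuous_on (cball 0 1) h"
    unfolding h_def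
    by (rule continuous_on_compose2[OF contg
          linear_continuous_on[OF bounded_linear_scalar_mult_vec_left]])
       (use line_in in \<open>force simp: less_imp_le\<close>)
  have inner: "z \<in> ?W" if "z \<in> ?S" "norm \<xi> \<le> 1" "f z = \<xi> *s b" for z \<xi>
    using that line_in by auto
  have tr: "ereal (truncate_at c' \<phi> z) = max (\<phi> z) (ereal (- c'))" if "z \<in> D" for c' z
    using ereal_truncate_at[of \<phi> z c'] psh that by (auto simp: plurisubharmonic_on_def)
  note MP = slice_maximum_principle[OF holo line_subharmonic_on_truncate_at[OF psh]
      open_truncate_at_less[OF psh D] S _ W, where b = b and p = p]
  have circle: "\<exists>t. norm (t - complex_of_real \<alpha>) = \<sigma> \<and> 2 * \<delta> < norm (h t - p)"
    if \<sigma>: "0 < \<sigma>" "\<sigma> \<le> 1 - \<alpha>" for \<sigma>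
  proof (rule ccontr)
    assume "\<not> ?thesis"
    then have near: "norm (h t - p) \<le> 2 * \<delta>" if "norm (t - complex_of_real \<alpha>) = \<sigma>" for t
      using that by (metis linorder_not_le)
    have t0: "truncate_at 0 \<phi> z = 0" if "z \<in> D" for z
    proof -
      have "ereal (truncate_at 0 \<phi> z) = 0" using tr[OF that, of 0] less_imp_le[OF neg[OF that]]
        by (simp add: zero_ereal_def max_absorb2)
      then show ?thesis by simp
    qed
    have unit: "norm t \<le> 1" if "t \<in> cball (complex_of_real \<alpha>) \<sigma>" for t
    proof -
      have "norm t \<le> norm (complex_of_real \<alpha>) + norm (t - complex_of_real \<alpha>)"
        using norm_triangle_ineq[of "complex_of_real \<alpha>" "t - complex_of_real \<alpha>"] by simp
      then show ?thesis using that \<sigma> \<alpha> by (simp add: dist_norm norm_minus_commute)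
    qed
    \<comment> \<open>Truncation at 0 turns \<open>\<phi>\<close> into the zero function, so only
      the penalties remain. On the circle each is at most \<open>4 * \<delta>\<^sup>2\<close>,
      whereas at \<open>z\<^sub>1\<close> the first alone is at least
      \<open>16 * \<delta>\<^sup>2\<close>.\<close>
    have "truncate_at 0 \<phi> z\<^sub>1 + 1 * (norm (z\<^sub>1 - p))\<^sup>2 + 4 * \<delta>\<^sup>2 * (norm (complex_of_real \<alpha>))\<^sup>2
        \<le> 8 * \<delta>\<^sup>2"
    proof (rule MP[where X = "cball (complex_of_real \<alpha>) \<sigma>" and Y = "ball (complex_of_real \<alpha>) \<sigma>"])
      show "\<exists>r>0. \<exists>G. G holomorphic_on ball 0 r \<and> G 0 = 0 \<and>
               (\<forall>\<zeta>\<in>ball 0 r. 8 * \<delta>\<^sup>2 = 8 * \<delta>\<^sup>2 + Re (G \<zeta>))"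
        by (intro exI[of _ 1] exI[of _ "\<lambda>_. 0"] conjI) auto
      show "f z\<^sub>1 = complex_of_real \<alpha> *s b" by (rule fz1)
      show "z\<^sub>1 \<in> ?S" using fz1 line_in[of "complex_of_real \<alpha>"] z1 \<alpha> by auto
      fix z \<xi> assume z: "z \<in> ?S" "f z = \<xi> *s b"
      show "z \<in> ?W" if "\<xi> \<in> cball (complex_of_real \<alpha>) \<sigma>" using inner[OF z(1) unit[OF that] z(2)] .
      assume \<xi>: "\<xi> \<in> cball (complex_of_real \<alpha>) \<sigma> - ball (complex_of_real \<alpha>) \<sigma>"
      then have n: "norm \<xi> \<le> 1" using unit by auto
      have "norm (z - p) \<le> 2 * \<delta>"
        using near[of \<xi>] h_eq[OF _ n z(2)] z \<xi> by (auto simp: dist_norm norm_minus_commute)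
      then have "(norm (z - p))\<^sup>2 \<le> (2 * \<delta>)\<^sup>2" by (rule power_mono) simp
      moreover have "4 * \<delta>\<^sup>2 * (norm \<xi>)\<^sup>2 \<le> 4 * \<delta>\<^sup>2 * 1"
        using n by (intro mult_left_mono) (auto simp: power_le_one)
      ultimately show "truncate_at 0 \<phi> z + 1 * (norm (z - p))\<^sup>2 + 4 * \<delta>\<^sup>2 * (norm \<xi>)\<^sup>2 \<le> 8 * \<delta>\<^sup>2"
        using z t0 by (simp add: power_mult_distrib)
    qed (use \<sigma> \<delta> in auto)
    moreover have "(4 * \<delta>)\<^sup>2 \<le> (norm (z\<^sub>1 - p))\<^sup>2" using z1_far \<delta> by (intro power_mono) auto
    moreover have "4 * \<delta>\<^sup>2 * (norm (complex_of_real \<alpha>))\<^sup>2 \<ge> 0" by simp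
    moreover have "\<delta>\<^sup>2 > 0" using \<delta> by simp
    moreover have "(4 * \<delta>)\<^sup>2 = 16 * \<delta>\<^sup>2" by (simp add: power_mult_distrib)
    ultimately show False using t0[OF z1(1)] by linarith
  qed
  \<comment> \<open>Half the distance from \<open>\<alpha>\<close> to 1, so that circles of radius
    at most \<open>s\<close> around \<open>\<alpha>\<close> stay in the disc of radius
    \<open>\<beta> < 1\<close>.\<close>
  define s where "s = (1 - \<alpha>) / 2"
  have s: "0 < s" "s \<le> 1" "s < 1 - \<alpha>" using \<alpha> by (auto simp: s_def)
  define \<beta> where "\<beta> = (1 + \<alpha>) / 2"
  have \<beta>: "0 < \<beta>" "\<beta> < 1" "\<alpha> + s = \<beta>" using \<alpha> by (auto simp: \<beta>_def s_def field_simps)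
  have "uniformly_continuous_on (cball 0 1) h"
    by (rule compact_uniformly_continuous[OF conth compact_cball])
  then obtain e where e: "e > 0"
    "\<And>x y. x \<in> cball 0 1 \<Longrightarrow> y \<in> cball 0 1 \<Longrightarrow> dist y x < e \<Longrightarrow> dist (h y) (h x) < \<delta>"
    using \<delta> unfolding uniformly_continuous_on_def by metis
  \<comment> \<open>Within \<open>\<eta>\<close> of a zero, \<open>h\<close> varies by less than
    \<open>\<delta>\<close> and so keeps a distance of at least \<open>\<delta>\<close> from
    \<open>p\<close>, where \<open>\<phi>\<close> is at most \<open>- c\<close>.\<close>
  define \<eta> where "\<eta> = e / 2"
  have \<eta>: "\<eta> > 0" "\<eta> < e" using e by (auto simp: \<eta>_def)
  define N where "N = max 1 (nat \<lceil>ln (2 / \<eta>)\<rceil>)"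
  have N: "N \<ge> 1" "ln (2 / \<eta>) \<le> real N" unfolding N_def by linarith+
  have "\<exists>t. norm (t - complex_of_real \<alpha>) = real j * s / real N \<and> 2 * \<delta> < norm (h t - p)"
    if "j \<in> {1..N}" for j
  proof (rule circle)
    show "0 < real j * s / real N" using that s by auto
    have "real j * s \<le> real N * s" using that s by (intro mult_right_mono) auto
    then have "real j * s / real N \<le> s" using N by (simp add: field_simps)
    then show "real j * s / real N \<le> 1 - \<alpha>" using s by simp
  qed
  then obtain t where t: "\<And>j. j \<in> {1..N} \<Longrightarrow> norm (t j - complex_of_real \<alpha>) = real j * s / real N"
    "\<And>j. j \<in> {1..N} \<Longrightarrow> 2 * \<delta> < norm (h (t j) - p)" by metis
  have t_le: "norm (t j) \<le> \<beta>" if "j \<in> {1..N}" for j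
  proof -
    have "real j * s \<le> real N * s" using that s by (intro mult_right_mono) auto
    then have "real j * s / real N \<le> s" using N by (simp add: field_simps)
    then show ?thesis
      using norm_triangle_ineq[of "complex_of_real \<alpha>" "t j - complex_of_real \<alpha>"] t(1)[OF that] \<beta>(3) \<alpha>
      by simp
  qed
  have t_lt: "norm (t j) < 1" if "j \<in> {1..N}" for j using t_le[OF that] \<beta> by simp
  have low: "truncate_at c \<phi> (h \<xi>) = - c" if "norm \<xi> \<le> 1" "j \<in> {1..N}" "norm (\<xi> - t j) \<le> \<eta>" for \<xi> j
  proof -
    have "dist (h \<xi>) (h (t j)) < \<delta>"
      using that \<eta> t_lt[OF that(2)] by (intro e) (auto simp: dist_norm)
    then have "\<delta> \<le> norm (h \<xi> - p)"
      using t(2)[OF that(2)] norm_triangle_ineq[of "h (t j) - h \<xi>" "h \<xi> - p"]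
      by (simp add: dist_norm norm_minus_commute)
    then have "ereal (truncate_at c \<phi> (h \<xi>)) = ereal (- c)"
      using tr[OF h(1)[OF that(1)], of c] c(2)[OF h(1)[OF that(1)]] by (simp add: max_absorb2)
    then show ?thesis by simp
  qed
  have nonpos: "truncate_at c \<phi> z \<le> 0" if "z \<in> D" for z
  proof -
    have "ereal (truncate_at c \<phi> z) \<le> 0" using tr[OF that, of c] neg[OF that] c(1) by auto
    then show ?thesis by simp
  qed
  define B where "B = (\<lambda>\<xi>. \<Prod>j=1..N. blaschke_factor (t j) \<xi>)"
  have holB: "B holomorphic_on cball 0 1"
    unfolding B_def by (intro holomorphic_intros holomorphic_on_blaschke_factor t_lt)
  \<comment> \<open>Removing discs around the zeros keeps the logarithm finite. Points of
    \<open>X - Y\<close> lie on the unit circle or at distance \<open>\<eta>\<close> from some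
    zero.\<close>
  define X where "X = cball 0 1 - (\<Union>j\<in>{1..N}. ball (t j) \<eta>)"
  define Y where "Y = ball 0 1 - (\<Union>j\<in>{1..N}. cball (t j) \<eta>)"
  have XY: "compact X" "open Y" "Y \<subseteq> X"
    unfolding X_def Y_def by (auto intro!: compact_diff open_Diff closed_UN)
  have far: "\<eta> \<le> norm (\<xi> - t j)" if "\<xi> \<in> X" "j \<in> {1..N}" for \<xi> j
    using that by (force simp: X_def dist_norm norm_minus_commute not_less)
  have B0: "B \<xi> \<noteq> 0" if "\<xi> \<in> X" for \<xi>
  proof -
    have "blaschke_factor (t j) \<xi> \<noteq> 0" if j: "j \<in> {1..N}" for j
      using norm_blaschke_factor_ge[OF t_lt[OF j], of \<xi>] far[OF \<open>\<xi> \<in> X\<close> j] \<eta> \<open>\<xi> \<in> X\<close>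
      by (auto simp: X_def)
    then show ?thesis by (simp add: B_def)
  qed
  define A where "A = blaschke_bound s"
  have A: "A > 0" unfolding A_def by (rule blaschke_bound_pos[OF s(1,2)])
  define \<kappa> where "\<kappa> = c / A"
  have \<kappa>: "\<kappa> > 0" using c A by (simp add: \<kappa>_def)
  define \<epsilon> where "\<epsilon> = peak_gap \<alpha> c"
  have \<epsilon>: "\<epsilon> = - \<kappa> * ln \<beta> / 2" unfolding \<epsilon>_def peak_gap_def \<kappa>_def A_def s_def \<beta>_def ..
  have \<epsilon>_pos: "\<epsilon> > 0" unfolding \<epsilon>_def by (rule peak_gap_pos[OF \<alpha> c(1)])
  have "bounded ((\<lambda>z. z - p) ` ?S)"
    using S by (intro compact_imp_bounded compact_continuous_image continuous_intros)
  then obtain M where M: "M > 0" "\<And>z. z \<in> ?S \<Longrightarrow> norm (z - p) \<le> M"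
    unfolding bounded_pos by blast
  \<comment> \<open>Each of the two penalties is allotted half of \<open>\<epsilon>\<close>.\<close>
  define \<kappa>\<^sub>1 where "\<kappa>\<^sub>1 = \<epsilon> / (2 * M\<^sup>2)"
  have \<kappa>1: "\<kappa>\<^sub>1 > 0" using \<epsilon>_pos M by (simp add: \<kappa>\<^sub>1_def)
  \<comment> \<open>The scaled logarithm of the Blaschke product; the summand
    \<open>\<epsilon>\<close> absorbs the penalties.\<close>
  define q where "q = (\<lambda>\<xi>. \<kappa> / real N * ln (norm (B \<xi>)) + \<epsilon>)"
  have penal: "\<kappa>\<^sub>1 * (norm (z - p))\<^sup>2 + \<epsilon> / 2 * (norm \<xi>)\<^sup>2 \<le> \<epsilon>" if "z \<in> ?S" "norm \<xi> \<le> 1" for z \<xi>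
  proof -
    have "\<kappa>\<^sub>1 * (norm (z - p))\<^sup>2 \<le> \<kappa>\<^sub>1 * M\<^sup>2"
      using M(2)[OF that(1)] \<kappa>1 by (intro mult_left_mono power_mono) auto
    also have "\<dots> = \<epsilon> / 2" using M(1) by (simp add: \<kappa>\<^sub>1_def)
    finally have "\<kappa>\<^sub>1 * (norm (z - p))\<^sup>2 \<le> \<epsilon> / 2" .
    moreover have "\<epsilon> / 2 * (norm \<xi>)\<^sup>2 \<le> \<epsilon> / 2 * 1"
      using that(2) \<epsilon>_pos by (intro mult_left_mono) (auto simp: power_le_one)
    ultimately show ?thesis by simp
  qed
  have h0: "h 0 = z\<^sub>0" using h_eq[of z\<^sub>0 0] z0 by simp
  have gap: "- c < truncate_at c \<phi> z\<^sub>0" "- \<epsilon> < truncate_at c \<phi> z\<^sub>0"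
  proof -
    have "ereal (- min c \<epsilon>) < ereal (truncate_at c \<phi> z\<^sub>0)"
      unfolding tr[OF z0(1)] using z0(3) by (simp add: \<epsilon>_def less_max_iff_disj)
    then show "- c < truncate_at c \<phi> z\<^sub>0" "- \<epsilon> < truncate_at c \<phi> z\<^sub>0" by auto
  qed
  \<comment> \<open>At parameter 0 the disc passes through \<open>z\<^sub>0\<close>, where the
    truncated function exceeds \<open>- c\<close>; within \<open>\<eta>\<close> of a zero it equals
    \<open>- c\<close>.\<close>
  have "0 \<in> X"
  proof -
    have "\<not> norm (t j) < \<eta>" if "j \<in> {1..N}" for j
      using low[of 0 j] that gap(1) h0 by auto
    then show ?thesis by (force simp: X_def)
  qed
  have "truncate_at c \<phi> z\<^sub>0 + \<kappa>\<^sub>1 * (norm (z\<^sub>0 - p))\<^sup>2 + \<epsilon> / 2 * (norm (0 :: complex))\<^sup>2 \<le> q 0"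
  proof (rule MP[OF _ _ XY])
    show "continuous_on X q"
      unfolding q_def
      by (intro continuous_intros continuous_on_subset[OF holomorphic_on_imp_continuous_on[OF holB]])
         (use B0 in \<open>auto simp: X_def\<close>)
    show "\<exists>r>0. \<exists>G. G holomorphic_on ball 0 r \<and> G 0 = 0 \<and>
             (\<forall>\<zeta>\<in>ball 0 r. q (\<xi> + \<zeta>) = q \<xi> + Re (G \<zeta>))" if "\<xi> \<in> Y" for \<xi>
    proof -
      have hol: "B holomorphic_on Y" by (rule holomorphic_on_subset[OF holB]) (auto simp: Y_def)
      have nz: "B \<xi> \<noteq> 0" using B0 that XY(3) by blast
      obtain r G where G: "r > 0" "G holomorphic_on ball 0 r" "G 0 = 0"
        "\<And>\<zeta>. \<zeta> \<in> ball 0 r \<Longrightarrow> ln (norm (B (\<xi> + \<zeta>))) = ln (norm (B \<xi>)) + Re (G \<zeta>)"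
        using ln_norm_holomorphic_local[OF hol XY(2) \<open>\<xi> \<in> Y\<close> nz] by blast
      show ?thesis
      proof (intro exI[of _ r] exI[of _ "\<lambda>\<zeta>. complex_of_real (\<kappa> / real N) * G \<zeta>"] conjI ballI)
        fix \<zeta> :: complex assume \<zeta>: "\<zeta> \<in> ball 0 r"
        have "Re (complex_of_real x * y) = x * Re y" for x y by simp
        then show "q (\<xi> + \<zeta>) = q \<xi> + Re (complex_of_real (\<kappa> / real N) * G \<zeta>)"
          unfolding q_def G(4)[OF \<zeta>] by (simp only: distrib_left)
      qed (use G in \<open>auto intro!: holomorphic_intros\<close>)
    qed
    show "\<kappa>\<^sub>1 > 0" "\<epsilon> / 2 > 0" using \<kappa>1 \<epsilon>_pos by auto
    show "z\<^sub>0 \<in> ?S" "f z\<^sub>0 = 0 *s b" using z0 \<rho>_pos by auto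
    show "0 \<in> X" by fact
    fix z \<xi> assume z: "z \<in> ?S" "f z = \<xi> *s b"
    show "z \<in> ?W" if "\<xi> \<in> X" using inner[OF z(1) _ z(2)] that by (auto simp: X_def)
    assume \<xi>: "\<xi> \<in> X - Y"
    then have n: "norm \<xi> \<le> 1" by (auto simp: X_def)
    have z_eq: "z = h \<xi>" using h_eq z n by auto
    \<comment> \<open>On the unit circle the logarithm vanishes and the left side is nonpositive.
      Near a zero the left side is \<open>- c\<close>, which is a lower bound for the scaled
      logarithm.\<close>
    have "truncate_at c \<phi> z \<le> \<kappa> / real N * ln (norm (B \<xi>))"
    proof (cases "norm \<xi> = 1")
      case True
      then have "norm (B \<xi>) = 1"
        unfolding B_def prod_norm[symmetric] using norm_blaschke_factor_circle t_lt by simp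
      then show ?thesis using nonpos z by simp
    next
      case False
      then obtain j where j: "j \<in> {1..N}" "norm (\<xi> - t j) \<le> \<eta>"
        using \<xi> n by (auto simp: Y_def dist_norm norm_minus_commute)
      have "\<kappa> / real N * (- real N * A) \<le> \<kappa> / real N * ln (norm (B \<xi>))"
        unfolding A_def B_def using \<kappa> \<xi> n
        by (intro mult_left_mono ln_norm_blaschke_product_ge[OF N(1) s(1,2) t(1) t_lt \<eta>(1) N(2) far]) auto
      moreover have "\<kappa> / real N * (- real N * A) = - c" using N A by (simp add: \<kappa>_def)
      ultimately show ?thesis using low[OF n j] z_eq by simp
    qed
    then show "truncate_at c \<phi> z + \<kappa>\<^sub>1 * (norm (z - p))\<^sup>2 + \<epsilon> / 2 * (norm \<xi>)\<^sup>2 \<le> q \<xi>"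
      using penal[OF z(1) n] by (simp add: q_def)
  qed auto
  moreover have "\<kappa>\<^sub>1 * (norm (z\<^sub>0 - p))\<^sup>2 \<ge> 0" using \<kappa>1 by simp
  \<comment> \<open>At 0 the product has modulus at most \<open>\<beta> ^ N\<close>. Its scaled
    logarithm is therefore at most \<open>\<kappa> * ln \<beta>\<close>, that is
    \<open>- 2 * \<epsilon>\<close>, and adding \<open>\<epsilon>\<close> leaves
    \<open>- \<epsilon>\<close>.\<close>
  moreover have "q 0 \<le> - \<epsilon>"
  proof -
    have "norm (B 0) = (\<Prod>j=1..N. norm (t j))"
      unfolding B_def prod_norm[symmetric] by (simp add: blaschke_factor_def)
    also have "\<dots> \<le> (\<Prod>j=1..N. \<beta>)" by (rule prod_mono) (use t_le in auto)
    finally have "norm (B 0) \<le> \<beta> ^ N" by simp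
    then have "ln (norm (B 0)) \<le> ln (\<beta> ^ N)" using B0[OF \<open>0 \<in> X\<close>] by (intro ln_mono) auto
    also have "\<dots> = real N * ln \<beta>" using \<beta> by (simp add: ln_realpow)
    finally have "\<kappa> / real N * ln (norm (B 0)) \<le> \<kappa> / real N * (real N * ln \<beta>)"
      using \<kappa> by (intro mult_left_mono) auto
    also have "\<dots> = \<kappa> * ln \<beta>" using N by simp
    finally have "q 0 \<le> \<kappa> * ln \<beta> + \<epsilon>" unfolding q_def by (rule add_right_mono)
    also have "\<dots> = - \<epsilon>" by (simp add: \<epsilon>)
    finally show ?thesis .
  qed
  ultimately show False using gap(2) by simp
qed

section \<open>Competitors for the squeezing function and conclusion\<close>

lemma squeezing_radius_le_1:
  fixes f :: "complex^'n \<Rightarrow> complex^'n"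
  assumes "f ` D \<subseteq> ball 0 1" "ball 0 r \<subseteq> f ` D"
  shows "r \<le> 1"
proof -
  have "ball (0 :: complex^'n) r \<subseteq> ball 0 1" using assms by blast
  then show ?thesis unfolding ball_subset_ball_iff by auto
qed

text \<open>Translating \<open>f z\<close> to 0 may double the norm, which the factor 1/2
  compensates; invariance of domain supplies the ball. Hence the supremum in
  \<open>squeezing\<close> is over a nonempty set.\<close>

lemma exists_centered_injection:
  fixes f :: "complex^'n \<Rightarrow> complex^'n"
  assumes "open D" "z \<in> D" and holo: "holomorphic_map_on f D" and im: "f ` D \<subseteq> ball 0 1" and inj: "inj_on f D"
  shows "\<exists>r>0. \<exists>g :: complex^'n \<Rightarrow> complex^'n.
           holomorphic_map_on g D \<and> g ` D \<subseteq> ball 0 1 \<and> inj_on g D \<and> g z = 0 \<and> ball 0 r \<subseteq> g ` D"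
proof -
  define g where "g = (\<lambda>y. (1 / 2 :: real) *\<^sub>R (f y - f z))"
  have g: "holomorphic_map_on g D"
    unfolding holomorphic_map_on_def
  proof
    fix y assume "y \<in> D"
    then obtain f' where f': "(f has_derivative f') (at y)" "\<forall>c v. f' (c *s v) = c *s f' v"
      using holo by (meson holomorphic_map_on_def)
    have "(g has_derivative (\<lambda>v. (1 / 2 :: real) *\<^sub>R f' v)) (at y)"
      unfolding g_def by (auto intro!: derivative_eq_intros f'(1))
    moreover have "(1 / 2 :: real) *\<^sub>R f' (c *s v) = c *s ((1 / 2 :: real) *\<^sub>R f' v)" for c v
      using f'(2) by (simp add: vec_eq_iff scaleR_conv_of_real)
    ultimately show "\<exists>g'. (g has_derivative g') (at y) \<and> (\<forall>c v. g' (c *s v) = c *s g' v)" by blast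
  qed
  have "norm (f y - f z) < 2" if "y \<in> D" for y
  proof -
    have "norm (f y) < 1" "norm (f z) < 1" using im that \<open>z \<in> D\<close> by auto
    then show ?thesis using norm_triangle_ineq4[of "f y" "f z"] by simp
  qed
  then have im_g: "g ` D \<subseteq> ball 0 1" by (auto simp: g_def)
  have inj_g: "inj_on g D" using inj by (auto simp: g_def inj_on_def)
  have "open (g ` D)"
    by (rule invariance_of_domain[OF continuous_on_holomorphic_map_on[OF g] \<open>open D\<close> inj_g])
  moreover have "g z = 0" by (simp add: g_def)
  then have "0 \<in> g ` D" using \<open>z \<in> D\<close> by force
  ultimately obtain r where "r > 0" "ball 0 r \<subseteq> g ` D" by (meson openE)
  then show ?thesis using g im_g inj_g \<open>g z = 0\<close> by blast
qed

text \<open>A value above \<open>\<rho> \<ge> 0\<close> is not the default 0 but a supremum, and a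
  radius strictly beyond \<open>\<rho>\<close> leaves room for the closed ball.\<close>

lemma less_squeezingE:
  fixes D :: "(complex^'n) set"
  assumes "open D" "z \<in> D" "0 \<le> \<rho>" "\<rho> < squeezing D z"
  obtains f :: "complex^'n \<Rightarrow> complex^'n" where "holomorphic_map_on f D" "f ` D \<subseteq> ball 0 1"
    "inj_on f D" "f z = 0" "cball 0 \<rho> \<subseteq> f ` D"
proof -
  let ?P = "\<lambda>r. \<exists>f :: complex^'n \<Rightarrow> complex^'n.
     holomorphic_map_on f D \<and> f ` D \<subseteq> ball 0 1 \<and> inj_on f D \<and> f z = 0 \<and> ball 0 r \<subseteq> f ` D"
  have ex: "\<exists>f :: complex^'n \<Rightarrow> complex^'n. holomorphic_map_on f D \<and> f ` D \<subseteq> ball 0 1 \<and> inj_on f D"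
    using assms(3,4) unfolding squeezing_def by (auto split: if_splits)
  then have sq: "squeezing D z = Sup {r. r > 0 \<and> ?P r}" unfolding squeezing_def by simp
  have "{r. r > 0 \<and> ?P r} \<noteq> {}"
  proof -
    obtain f :: "complex^'n \<Rightarrow> complex^'n" where "holomorphic_map_on f D" "f ` D \<subseteq> ball 0 1" "inj_on f D"
      using ex by metis
    from exists_centered_injection[OF assms(1,2) this]
    obtain r where "r \<in> {r. r > 0 \<and> ?P r}" by auto
    then show ?thesis by (metis empty_iff)
  qed
  from less_cSupE[OF assms(4)[unfolded sq] this]
  obtain r where "r \<in> {r. r > 0 \<and> ?P r}" and r: "\<rho> < r" .
  then obtain f :: "complex^'n \<Rightarrow> complex^'n" where f: "holomorphic_map_on f D" "f ` D \<subseteq> ball 0 1"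
    "inj_on f D" "f z = 0" "ball 0 r \<subseteq> f ` D" by blast
  have "cball (0 :: complex^'n) \<rho> \<subseteq> ball 0 r" using r by auto
  then show ?thesis using f by (intro that[of f]) auto
qed

lemma squeezing_bounds:
  fixes f :: "complex^'n \<Rightarrow> complex^'n"
  assumes f: "holomorphic_map_on f D" "f ` D \<subseteq> ball 0 1" "inj_on f D" "f z = 0" "ball 0 r \<subseteq> f ` D"
    and r: "r > 0"
  shows "r \<le> squeezing D z" "squeezing D z \<le> 1"
proof -
  let ?P = "\<lambda>r. \<exists>f :: complex^'n \<Rightarrow> complex^'n.
     holomorphic_map_on f D \<and> f ` D \<subseteq> ball 0 1 \<and> inj_on f D \<and> f z = 0 \<and> ball 0 r \<subseteq> f ` D"
  have "\<exists>f :: complex^'n \<Rightarrow> complex^'n. holomorphic_map_on f D \<and> f ` D \<subseteq> ball 0 1 \<and> inj_on f D"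
    using f by blast
  then have sq: "squeezing D z = Sup {r. r > 0 \<and> ?P r}" unfolding squeezing_def by simp
  have le1: "x \<le> 1" if "x \<in> {r. r > 0 \<and> ?P r}" for x
    using that squeezing_radius_le_1 by blast
  have mem: "r \<in> {r. r > 0 \<and> ?P r}" using f r by blast
  show "r \<le> squeezing D z" unfolding sq by (rule cSup_upper[OF mem]) (use le1 in \<open>auto simp: bdd_above_def\<close>)
  show "squeezing D z \<le> 1" unfolding sq by (rule cSup_least) (use mem le1 in auto)
qed

theorem proposition2:
  fixes D U :: "(complex^'n) set" and p0 :: "complex^'n"
  assumes "open D" and "connected D" and "D \<noteq> {}"
    and "open U" and "p0 \<in> U"
    and "psh_peak_point D p0"
    and "(squeezing D \<longlongrightarrow> 1) (at p0 within D)"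
  shows "(squeezing (D \<inter> U) \<longlongrightarrow> 1) (at p0 within (D \<inter> U))"
proof (rule tendstoI)
  fix e :: real assume "e > 0"
  \<comment> \<open>The maximum with 1/2 keeps \<open>r\<close> positive when \<open>e\<close> is
    large.\<close>
  define r where "r = max (1 / 2) (1 - e / 2)"
  have r: "0 < r" "r < 1" "1 - r < e" using \<open>e > 0\<close> by (auto simp: r_def)
  \<comment> \<open>Both \<open>\<alpha>\<close> and \<open>\<rho>\<close> are below 1 with
    \<open>r < \<alpha> * \<rho>\<close>, so the ball covered by \<open>localization\<close>
    contains the ball of radius \<open>r\<close>.\<close>
  define \<alpha> where "\<alpha> = (1 + r) / 2"
  have \<alpha>: "0 < \<alpha>" "\<alpha> < 1" "r < \<alpha>" using r by (auto simp: \<alpha>_def)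
  define \<rho> where "\<rho> = (r / \<alpha> + 1) / 2"
  have "r / \<alpha> < 1" "r / \<alpha> > 0" using r \<alpha> by auto
  moreover have "0 < (x + 1) / 2 \<and> (x + 1) / 2 < 1 \<and> x < (x + 1) / 2" if "x < 1" "x > 0" for x :: real
    using that by auto
  ultimately have \<rho>: "0 < \<rho>" "\<rho> < 1" "r / \<alpha> < \<rho>" unfolding \<rho>_def by blast+
  have r_less: "r < \<alpha> * \<rho>" using \<rho>(3) \<alpha> by (simp add: field_simps)
  obtain d where d: "d > 0" "ball p0 d \<subseteq> U" using assms(4,5) by (meson openE)
  \<comment> \<open>\<open>localization\<close> gives a distance below \<open>4 * \<delta>\<close>,
    which is \<open>d\<close>.\<close>
  define \<delta> where "\<delta> = d / 4"
  have \<delta>: "\<delta> > 0" using d by (simp add: \<delta>_def)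
  obtain \<phi> where psh: "plurisubharmonic_on \<phi> D" and neg: "\<And>z. z \<in> D \<Longrightarrow> \<phi> z < 0"
    and lim: "(\<phi> \<longlongrightarrow> 0) (at p0 within D)"
    and peak: "\<And>V. open V \<Longrightarrow> p0 \<in> V \<Longrightarrow> (SUP z\<in>D - V. \<phi> z) < 0"
    using assms(6) unfolding psh_peak_point_def by blast
  \<comment> \<open>A real number is interposed because the supremum may be
    \<open>- \<infinity>\<close>, for instance over the empty set.\<close>
  obtain x where x: "(SUP z\<in>D - ball p0 \<delta>. \<phi> z) < ereal x" "ereal x < 0"
    using ereal_dense2[OF peak[OF open_ball, of p0 \<delta>]] \<delta> by auto
  define c where "c = - x"
  have c: "c > 0" using x(2) by (simp add: c_def)
  have far: "\<phi> z \<le> ereal (- c)" if "z \<in> D" "\<delta> \<le> norm (z - p0)" for z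
  proof -
    have "z \<in> D - ball p0 \<delta>" using that by (auto simp: dist_norm norm_minus_commute)
    then have "\<phi> z \<le> (SUP z\<in>D - ball p0 \<delta>. \<phi> z)" by (rule SUP_upper)
    then show ?thesis using x(1) by (simp add: c_def)
  qed
  define \<epsilon> where "\<epsilon> = min c (peak_gap \<alpha> c)"
  have "\<epsilon> > 0" using c peak_gap_pos[OF \<alpha>(1,2) c] by (simp add: \<epsilon>_def)
  then have "\<forall>\<^sub>F z in at p0 within D. ereal (- \<epsilon>) < \<phi> z"
    by (intro order_tendstoD(1)[OF lim]) simp
  moreover have "\<forall>\<^sub>F z in at p0 within D. \<rho> < squeezing D z"
    by (rule order_tendstoD(1)[OF assms(7) \<rho>(2)])
  ultimately have "\<forall>\<^sub>F z in at p0 within D. ereal (- \<epsilon>) < \<phi> z \<and> \<rho> < squeezing D z"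
    by (rule eventually_conj)
  then have "\<forall>\<^sub>F z in at p0 within (D \<inter> U). ereal (- \<epsilon>) < \<phi> z \<and> \<rho> < squeezing D z"
    by (rule filter_leD[OF at_le, rotated]) auto
  moreover have "\<forall>\<^sub>F z in at p0 within (D \<inter> U). z \<in> D \<inter> U"
    by (simp add: eventually_at_filter)
  ultimately show "\<forall>\<^sub>F z in at p0 within (D \<inter> U). dist (squeezing (D \<inter> U) z) 1 < e"
  proof eventually_elim
    case (elim z)
    then have z: "z \<in> D" "z \<in> U" "ereal (- \<epsilon>) < \<phi> z" "\<rho> < squeezing D z" by auto
    obtain f :: "complex^'n \<Rightarrow> complex^'n" where f: "holomorphic_map_on f D" "f ` D \<subseteq> ball 0 1"
      "inj_on f D" "f z = 0" "cball 0 \<rho> \<subseteq> f ` D"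
      using less_squeezingE[OF assms(1) z(1) less_imp_le[OF \<rho>(1)] z(4)] by metis
    have in_U: "y \<in> U" if "y \<in> D" "norm (f y) < \<alpha> * \<rho>" for y
    proof -
      have "norm (y - p0) < 4 * \<delta>"
        by (rule localization[OF assms(1) f(1,3,5) psh neg c far \<delta> \<alpha>(1,2) z(1) f(4)
              z(3)[unfolded \<epsilon>_def] that])
      then show ?thesis using d(2) by (auto simp: \<delta>_def dist_norm norm_minus_commute)
    qed
    have "ball 0 r \<subseteq> f ` (D \<inter> U)"
    proof
      fix w :: "complex^'n" assume "w \<in> ball 0 r"
      then have w: "norm w < \<alpha> * \<rho>" using r_less by simp
      moreover have "\<alpha> * \<rho> \<le> \<rho>" using \<alpha> \<rho> by simp
      ultimately have "w \<in> cball 0 \<rho>" by simp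
      then obtain y where "y \<in> D" "w = f y" using f(5) by blast
      then show "w \<in> f ` (D \<inter> U)" using in_U w by auto
    qed
    moreover have "holomorphic_map_on f (D \<inter> U)" using f(1) by (simp add: holomorphic_map_on_def)
    moreover have "f ` (D \<inter> U) \<subseteq> ball 0 1" using f(2) by blast
    moreover have "inj_on f (D \<inter> U)" using f(3) by (rule inj_on_subset) auto
    ultimately have "r \<le> squeezing (D \<inter> U) z" "squeezing (D \<inter> U) z \<le> 1"
      using squeezing_bounds[of f "D \<inter> U" z r] f(4) r(1) by auto
    then show ?case using r(3) by (simp add: dist_real_def)
  qed
qed

end
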